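(* Let $0.5208<\sigma_0<0.9723$ and $10^3\le H<H_0$, where $H_0=3.061\cdot10^{10}$. Then for all $T\ge H_0$, \[ \frac{1}{T-H}\int_H^T|\zeta(\sigma_0+it)|^2\,dt\le \zeta(2\sigma_0)+\mathcal{E}_1(\sigma_0,H), \] and \[ \int_H^T\log|\zeta(\sigma_0+it)|\,dt\le\frac{T-H}{2}\log\big(\zeta(2\sigma_0)+\mathcal{E}_1(\sigma_0,H)\big). \]
   Context: $\zeta$ is the Riemann zeta function. Constants: $H_0=3.061\cdot10^{10}$, $c_0=2.1946$. Define \[ \epsilon_1(\sigma_0,H)=\frac{4H_0}{H_0-H}\Big(\frac{(\log H_0)H_0^{1-2\sigma_0}}{2(1-\sigma_0)}-\frac{(2\sigma_0-1)\log H_0}{2(1-\sigma_0)H_0}+\frac{\max\big(0,\frac{1-3\sigma_0+3\sigma_0^2}{2(1-\sigma_0)^2}-\frac{\zeta(2\sigma_0)}{2}\big)}{H_0}+\frac{(2-\sigma_0)H_0^{1-2\sigma_0}}{2(1-\sigma_0)^2}-\frac{\sigma_0H_0^{-\sigma_0}}{(1-\sigma_0)^2}+\frac{H_0^{-2\sigma_0}}{2(2\sigma_0-1)}+\frac{H_0^{-2\sigma_0-1}}{2}\Big), \] \[ \epsilon_2(\sigma_0,H)=\frac{c_0^2}{2\sigma_0-1}\cdot\frac{H^{-(2\sigma_0-1)}-H_0^{-(2\sigma_0-1)}}{H_0-H},\qquad \epsilon_3(\sigma_0,H)=2\sqrt{\epsilon_2(\sigma_0,H)\big(\zeta(2\sigma_0)+\epsilon_1(\sigma_0,H)\big)},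 \] and $\mathcal{E}_1(\sigma_0,H)=\epsilon_1(\sigma_0,H)+\epsilon_2(\sigma_0,H)+\epsilon_3(\sigma_0,H)$. *)

theory Defs
  imports "HOL-Analysis.Analysis"
begin

text \<open>Riemann zeta function on the half plane Re s > 0, s \<noteq> 1, via the classical
  limit formula  zeta(s) = lim_N ( sum_{n=1}^N n^(-s) - N^(1-s)/(1-s) ),
  which coincides with the Dirichlet series for Re s > 1 and gives the analytic
  continuation to Re s > 0.\<close>
definition zeta :: "complex \<Rightarrow> complex" where
  "zeta s = lim (\<lambda>N::nat. (\<Sum>n=1..N. 1 / (of_nat n) powr s)
                          - (of_nat N) powr (1 - s) / (1 - s))"

definition H0 :: real where "H0 = 3.061 * 10 ^ 10"
definition c0 :: real where "c0 = 2.1946"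

definition zr :: "real \<Rightarrow> real" where "zr x = Re (zeta (complex_of_real x))"

definition eps1 :: "real \<Rightarrow> real \<Rightarrow> real" where
  "eps1 \<sigma> H = 4 * H0 / (H0 - H) *
     ( ln H0 * H0 powr (1 - 2*\<sigma>) / (2 * (1 - \<sigma>))
     - (2*\<sigma> - 1) * ln H0 / (2 * (1 - \<sigma>) * H0)
     + max 0 ((1 - 3*\<sigma> + 3*\<sigma>^2) / (2 * (1 - \<sigma>)^2) - zr (2*\<sigma>) / 2) / H0
     + (2 - \<sigma>) * H0 powr (1 - 2*\<sigma>) / (2 * (1 - \<sigma>)^2)
     - \<sigma> * H0 powr (-\<sigma>) / (1 - \<sigma>)^2
     + H0 powr (-2*\<sigma>) / (2 * (2*\<sigma> - 1))
     + H0 powr (-2*\<sigma> - 1) / 2 )"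

definition eps2 :: "real \<Rightarrow> real \<Rightarrow> real" where
  "eps2 \<sigma> H = c0^2 / (2*\<sigma> - 1) * (H powr (-(2*\<sigma> - 1)) - H0 powr (-(2*\<sigma> - 1))) / (H0 - H)"

definition eps3 :: "real \<Rightarrow> real \<Rightarrow> real" where
  "eps3 \<sigma> H = 2 * sqrt (eps2 \<sigma> H * (zr (2*\<sigma>) + eps1 \<sigma> H))"

definition E1 :: "real \<Rightarrow> real \<Rightarrow> real" where
  "E1 \<sigma> H = eps1 \<sigma> H + eps2 \<sigma> H + eps3 \<sigma> H"

end

theory Submission
  imports Defs "HOL-Complex_Analysis.Complex_Analysis"
begin

text \<open>
  On the line \<open>Re s = \<sigma>0\<close> write \<open>zeta s = S t + R t\<close> with \<open>S t\<close> the sum of \<open>n powr (-s)\<close> over \<open>n \<le> t\<close>.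
  The tail of the zeta function beyond \<open>N = \<lfloor>t\<rfloor>\<close> is compared with an integral by the trapezoidal rule;
  the error of the \<open>n\<close>-th panel is \<open>(a n - a (n+1)) * r n\<close> with \<open>a n = n powr (-s)\<close> and \<open>r\<close> of small
  bounded variation, because the phase of \<open>a n\<close> turns by at most about one radian per step. Abel
  summation then gives \<open>\<bar>R t\<bar> \<le> c0 * t powr (-\<sigma>0)\<close>.

  Expanding the square of \<open>S\<close> and integrating termwise, the diagonal contributes at most
  \<open>(T - H) * zeta (2 * \<sigma>0)\<close> and the rest at most four times the sum of \<open>(n m) powr (-\<sigma>0) / ln (m/n)\<close>
  over \<open>n < m \<le> T\<close>, which \<open>1 / ln (m/n) \<le> 1 + n / (m - n)\<close> makes elementary. The resulting bound,
  divided by \<open>T\<close>, is decreasing for \<open>T \<ge> H0\<close>, so that \<open>T\<close> may be replaced by \<open>H0\<close>.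

  The mean square of \<open>S + R\<close> follows from the Cauchy-Schwarz inequality, used as
  \<open>(x + y)\<^sup>2 \<le> (1 + l) x\<^sup>2 + (1 + 1/l) y\<^sup>2\<close> with the optimal \<open>l\<close>; the logarithmic mean follows from
  Jensen's inequality, the zeros of zeta being countable.
\<close>

section \<open>The zeta function to the right of the imaginary axis\<close>

text \<open>The sequence whose \<open>lim\<close> is \<open>zeta\<close> by definition. With the
  index as first argument it is a sequence of functions, as uniform limits require.\<close>

definition zeta_approx :: "nat \<Rightarrow> complex \<Rightarrow> complex" where
  "zeta_approx N s = (\<Sum>n=1..N. 1 / (of_nat n) powr s) - (of_nat N) powr (1 - s) / (1 - s)"

lemma norm_nat_powr:
  "n > 0 \<Longrightarrow> norm ((of_nat n :: complex) powr s) = real n powr Re s"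
  using norm_powr_real_powr[of "of_nat n" s] by simp

text \<open>The increment is \<open>(n+1) powr (-s)\<close> minus the integral of
  \<open>z powr (-s)\<close> over one step. Bounding the variation of the integrand gains a factor
  \<open>norm s / n\<close>, so the increments are summable for every
  \<open>Re s > 0\<close>.\<close>

lemma zeta_approx_diff_bound:
  fixes s :: complex
  assumes "n \<ge> 1" and s: "Re s > 0" "s \<noteq> 1"
  shows "norm (zeta_approx (Suc n) s - zeta_approx n s) \<le> norm s * real n powr (- Re s - 1)"
proof -
  let ?m = "of_nat (Suc n) :: complex"
  let ?S = "closed_segment (of_nat n) ?m"
  have S: "z \<in> \<real> \<and> Re z \<ge> real n \<and> Re z \<le> real (Suc n)" if z: "z \<in> ?S" for z
  proof -
    from z obtain u where u: "0 \<le> u" "u \<le> 1" "z = (1 - u) *\<^sub>R of_nat n + u *\<^sub>R ?m"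
      by (auto simp: closed_segment_def)
    hence "z = of_real (real n + u)"
      by (simp add: scaleR_conv_of_real algebra_simps)
    thus ?thesis using u by auto
  qed
  have n0: "real n > 0" using assms by simp
  have nz: "z \<notin> \<real>\<^sub>\<le>\<^sub>0" "z \<noteq> 0" "Re z > 0" if z: "z \<in> ?S" for z
    using S[OF z] n0 by (auto simp: complex_nonpos_Reals_iff)
  have b: "norm (z powr (-s-1)) \<le> real n powr (-Re s - 1)" if z: "z \<in> ?S" for z
  proof -
    have "norm (z powr (-s-1)) = Re z powr (-Re s - 1)"
      using S[OF z] nz[OF z] by (subst norm_powr_real_powr) auto
    also have "\<dots> \<le> real n powr (-Re s - 1)"
      using S[OF z] n0 s by (intro powr_mono2') auto
    finally show ?thesis .
  qed
  have b2: "norm (z powr (-s) - ?m powr (-s)) \<le> norm s * real n powr (-Re s - 1)" if z: "z \<in> ?S" for z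
  proof -
    have "norm (z powr (-s) - ?m powr (-s)) \<le> (norm s * real n powr (-Re s - 1)) * norm (z - ?m)"
    proof (rule field_differentiable_bound[where S = ?S and f = "\<lambda>z. z powr (-s)" and f' = "\<lambda>z. -s * z powr (-s-1)"])
      fix w assume w: "w \<in> ?S"
      show "((\<lambda>z. z powr (-s)) has_field_derivative - s * w powr (- s - 1)) (at w within ?S)"
        using nz[OF w] by (auto intro!: derivative_eq_intros)
      show "norm (- s * w powr (- s - 1)) \<le> norm s * real n powr (- Re s - 1)"
        using b[OF w] by (simp add: norm_mult mult_left_mono)
    qed (use z in auto)
    also have "norm (z - ?m) \<le> 1"
    proof -
      have "z - ?m = of_real (Re z - real (Suc n))"
        using S[OF z] by (simp add: complex_eq_iff complex_is_Real_iff)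
      thus ?thesis using S[OF z] by (simp del: of_real_diff of_nat_Suc)
    qed
    hence "(norm s * real n powr (-Re s - 1)) * norm (z - ?m) \<le> (norm s * real n powr (-Re s - 1)) * 1"
      by (intro mult_left_mono) auto
    finally show ?thesis by simp
  qed
  \<comment> \<open>An antiderivative of \<open>z powr (-s) - ?m powr (-s)\<close>, which
    \<open>b2\<close> has just bounded; over the step of length 1 its increment is the negative of
    the difference sought.\<close>
  let ?h = "\<lambda>z. z powr (1-s) / (1-s) - z * ?m powr (-s)"
  have "norm (?h ?m - ?h (of_nat n)) \<le> (norm s * real n powr (-Re s - 1)) * norm (?m - of_nat n)"
  proof (rule field_differentiable_bound[where S = ?S and f = ?h and f' = "\<lambda>z. z powr (-s) - ?m powr (-s)"])
    fix w assume w: "w \<in> ?S"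
    show "(?h has_field_derivative w powr (-s) - ?m powr (-s)) (at w within ?S)"
      using nz[OF w] s by (auto intro!: derivative_eq_intros)
  qed (use b2 in auto)
  moreover have "zeta_approx (Suc n) s - zeta_approx n s = - (?h ?m - ?h (of_nat n))"
    by (simp add: zeta_approx_def powr_minus divide_inverse algebra_simps)
  ultimately show ?thesis
    by (simp add: norm_minus_commute)
qed

text \<open>Weierstrass M-test for the telescoping series of increments. Uniformity on such sets is
  what carries holomorphy over to the limit.\<close>

lemma uniform_limit_zeta_approx:
  assumes \<sigma>: "\<sigma> > 0" and A: "\<And>s. s \<in> A \<Longrightarrow> Re s \<ge> \<sigma> \<and> norm s \<le> C \<and> s \<noteq> 1"
  shows "uniform_limit A zeta_approx zeta sequentially"
proof (cases "A = {}")
  case True thus ?thesis by simp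
next
  case False
  hence C: "C \<ge> 0" using A norm_ge_zero order_trans by blast
  define D where "D = (\<lambda>n s. zeta_approx (Suc (Suc n)) s - zeta_approx (Suc n) s)"
  let ?g = "\<lambda>s. suminf (\<lambda>n. D n s)"
  have "summable (\<lambda>n. real n powr (-\<sigma> - 1))"
    using \<sigma> by (subst summable_real_powr_iff) auto
  hence "summable (\<lambda>n. real (Suc n) powr (-\<sigma> - 1))"
    by (subst summable_Suc_iff)
  hence sm: "summable (\<lambda>n. C * real (Suc n) powr (-\<sigma> - 1))"
    by (rule summable_mult)
  have bd: "norm (D n s) \<le> C * real (Suc n) powr (-\<sigma> - 1)" if s: "s \<in> A" for n s
  proof -
    have "norm (D n s) \<le> norm s * real (Suc n) powr (- Re s - 1)"
      unfolding D_def by (rule zeta_approx_diff_bound) (use A[OF s] \<sigma> in auto)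
    also have "\<dots> \<le> C * real (Suc n) powr (-\<sigma> - 1)"
      using A[OF s] C by (intro mult_mono powr_mono) auto
    finally show ?thesis .
  qed
  have ul: "uniform_limit A (\<lambda>n s. \<Sum>i<n. D i s) ?g sequentially"
    by (rule Weierstrass_m_test[OF bd sm])
  have tel: "(\<Sum>i<n. D i s) = zeta_approx (Suc n) s - zeta_approx 1 s" for n s
    unfolding D_def using sum_lessThan_telescope[of "\<lambda>i. zeta_approx (Suc i) s" n] by simp
  have "uniform_limit A (\<lambda>n s. (\<Sum>i<n. D i s) + zeta_approx 1 s) (\<lambda>s. ?g s + zeta_approx 1 s) sequentially"
    by (intro uniform_limit_add ul uniform_limit_const)
  hence "uniform_limit A (\<lambda>n. zeta_approx (Suc n)) (\<lambda>s. ?g s + zeta_approx 1 s) sequentially"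
    unfolding tel by simp
  hence ul2: "uniform_limit A zeta_approx (\<lambda>s. ?g s + zeta_approx 1 s) sequentially"
    using filterlim_sequentially_Suc by blast
  have "zeta s = ?g s + zeta_approx 1 s" if "s \<in> A" for s
  proof -
    have "(\<lambda>n. zeta_approx n s) \<longlonglongrightarrow> ?g s + zeta_approx 1 s"
      using tendsto_uniform_limitI[OF ul2 that] .
    thus ?thesis unfolding zeta_def zeta_approx_def by (rule limI)
  qed
  thus ?thesis
    using ul2 uniform_limit_cong'[of A zeta_approx zeta_approx zeta "\<lambda>s. ?g s + zeta_approx 1 s"] by simp
qed

lemma tendsto_zeta_approx:
  assumes "Re s > 0" "s \<noteq> 1"
  shows "(\<lambda>n. zeta_approx n s) \<longlonglongrightarrow> zeta s"
  by (rule tendsto_uniform_limitI[OF uniform_limit_zeta_approx[of "Re s" "{s}" "norm s"]])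
    (use assms in auto)

text \<open>Locally uniform limits of holomorphic functions are holomorphic. Starting at index 1
  keeps the base of every power off the branch cut of \<open>powr\<close>.\<close>

lemma holomorphic_zeta: "zeta holomorphic_on {s. Re s > 0} - {1}"
proof (rule holomorphic_uniform_sequence[where f = "\<lambda>n. zeta_approx (Suc n)"])
  show op: "open ({s. Re s > 0} - {1})"
    by (intro open_Diff open_halfspace_Re_gt) auto
  show "zeta_approx (Suc n) holomorphic_on {s. Re s > 0} - {1}" for n
    unfolding zeta_approx_def
    by (intro holomorphic_intros) (auto simp: complex_nonpos_Reals_iff simp del: of_nat_Suc)
  fix z :: complex assume z: "z \<in> {s. Re s > 0} - {1}"
  obtain e where e: "e > 0" "cball z e \<subseteq> {s. Re s > 0} - {1}"
    using op z open_contains_cball by blast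
  define d where "d = min e (Re z / 2)"
  have d: "d > 0" "cball z d \<subseteq> {s. Re s > 0} - {1}" using e z by (auto simp: d_def)
  have "uniform_limit (cball z d) zeta_approx zeta sequentially"
  proof (rule uniform_limit_zeta_approx[where \<sigma> = "Re z / 2" and C = "norm z + d"])
    show "Re z / 2 > 0" using z by simp
    fix s assume s: "s \<in> cball z d"
    have "\<bar>Re z - Re s\<bar> \<le> d" using abs_Re_le_cmod[of "z - s"] s by (simp add: dist_norm)
    moreover have "norm s \<le> norm z + d"
      using norm_triangle_sub[of s z] s by (simp add: dist_norm norm_minus_commute)
    ultimately show "Re z / 2 \<le> Re s \<and> norm s \<le> norm z + d \<and> s \<noteq> 1"
      using s d unfolding d_def by auto
  qed
  hence "uniform_limit (cball z d) (\<lambda>n. zeta_approx (Suc n)) zeta sequentially"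
    using filterlim_sequentially_Suc by blast
  with d show "\<exists>d. 0 < d \<and> cball z d \<subseteq> {s. Re s > 0} - {1} \<and>
      uniform_limit (cball z d) (\<lambda>n. zeta_approx (Suc n)) zeta sequentially" by blast
qed

text \<open>For exponents above 1 the correction term \<open>N powr (1 - x) / (1 - x)\<close> tends
  to 0, so the limit defining \<open>zeta\<close> reduces to the Dirichlet series.\<close>

lemma zeta_real_sums:
  fixes x :: real
  assumes x: "x > 1"
  shows "(\<lambda>n. real (Suc n) powr (-x)) sums zr x"
proof -
  have "(\<lambda>n. zeta_approx n (of_real x)) \<longlonglongrightarrow> zeta (of_real x)"
    by (rule tendsto_zeta_approx) (use x in auto)
  hence "(\<lambda>n. Re (zeta_approx n (of_real x))) \<longlonglongrightarrow> zr x"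
    unfolding zr_def by (rule tendsto_Re)
  moreover have "Re (zeta_approx n (of_real x)) = (\<Sum>k<n. real (Suc k) powr (-x)) - real n powr (1-x) / (1-x)" for n
  proof -
    have p: "(of_nat m :: complex) powr of_real y = of_real (real m powr y)" for m y
      using powr_of_real[of "real m" y] by simp
    have "(\<Sum>n=1..n. 1 / real n powr x) = (\<Sum>k<n. real (Suc k) powr (-x))"
      by (rule sum.reindex_bij_witness[of _ Suc "\<lambda>k. k - 1"]) (auto simp: powr_minus field_simps)
    moreover have "zeta_approx n (of_real x) = of_real ((\<Sum>n=1..n. 1 / real n powr x) - real n powr (1-x) / (1-x))"
      unfolding zeta_approx_def using p[of _ x] p[of n "1-x"] by simp
    ultimately show ?thesis by simp
  qed
  moreover have "(\<lambda>n. real n powr (1-x) / (1-x)) \<longlonglongrightarrow> 0"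
    using x by (intro tendsto_divide_zero tendsto_neg_powr filterlim_real_sequentially) auto
  ultimately have "(\<lambda>n. (\<Sum>k<n. real (Suc k) powr (-x)) - real n powr (1-x) / (1-x) + real n powr (1-x) / (1-x)) \<longlonglongrightarrow> zr x + 0"
    by (intro tendsto_add) auto
  thus ?thesis unfolding sums_def by simp
qed

lemma zr_ge_1: assumes "x > 1" shows "zr x \<ge> 1"
proof -
  have s: "(\<lambda>n. real (Suc n) powr (-x)) sums zr x" by (rule zeta_real_sums[OF assms])
  have "(\<Sum>n<1. real (Suc n) powr (-x)) \<le> zr x"
    unfolding sums_unique[OF s] by (rule sum_le_suminf) (use s in \<open>auto simp: summable_def\<close>)
  thus ?thesis by simp
qed

text \<open>A nonconstant holomorphic function on a connected open set has countably many zeros. A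
  constant \<open>zeta\<close> needs no exclusion: its value at 2 is nonzero, so it would have no
  zeros.\<close>

lemma countable_zeta_zeros: "countable {s. Re s > 0 \<and> s \<noteq> 1 \<and> zeta s = 0}"
proof -
  let ?S = "{s. Re s > 0} - {1::complex}"
  have op: "open ?S" by (intro open_Diff open_halfspace_Re_gt) auto
  have co: "connected ?S"
    by (rule connected_open_delete) (auto simp: open_halfspace_Re_gt convex_halfspace_Re_gt convex_connected)
  have "\<not> (\<forall>s\<in>?S. zeta s = 0)"
  proof
    assume "\<forall>s\<in>?S. zeta s = 0"
    hence "zeta (of_real 2) = 0" by auto
    thus False using zr_ge_1[of 2] by (simp add: zr_def)
  qed
  show ?thesis
  proof (cases "zeta constant_on ?S")
    case True
    then obtain c where c: "\<And>s. s \<in> ?S \<Longrightarrow> zeta s = c" unfolding constant_on_def by blast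
    hence "c \<noteq> 0" using \<open>\<not> (\<forall>s\<in>?S. zeta s = 0)\<close> by auto
    hence "{s. Re s > 0 \<and> s \<noteq> 1 \<and> zeta s = 0} = {}" using c by auto
    thus ?thesis by (simp only: countable_empty)
  next
    case False
    have "countable {z\<in>?S. zeta z = 0}"
      by (rule holomorphic_countable_zeros[OF holomorphic_zeta op co _ False])
         (metis (no_types, lifting) fsigma_Union_compact image_subsetI mem_Collect_eq open_Union_compact_subsets op)
    moreover have "{z\<in>?S. zeta z = 0} = {s. Re s > 0 \<and> s \<noteq> 1 \<and> zeta s = 0}" by auto
    ultimately show ?thesis by simp
  qed
qed

section \<open>Approximation by a partial sum\<close>

text \<open>The kernel \<open>1/(1 - exp (-z)) - 1/2 - 1/z\<close> measures how far the trapezoidal rule is from being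
  exact on \<open>\<lambda>u. exp (-z * u)\<close>.\<close>

definition trap_kernel :: "complex \<Rightarrow> complex" where
  "trap_kernel z = 1 / (1 - exp (-z)) - 1/2 - 1/z"

text \<open>Here \<open>w\<close> will be \<open>z / 2\<close> with
  \<open>norm z \<le> 102/100\<close>. The constants round up 1/6 + 2/100 and 1/3 + 8/100 + 2/100,
  the leading Taylor coefficients plus the remainders \<open>S\<close> and \<open>C\<close>.\<close>

lemma sinh_cosh_taylor_bounds:
  fixes w :: complex
  assumes w: "norm w \<le> 51/100"
  shows "norm (sinh w - w) \<le> 19/100 * norm w ^ 3"
    and "norm (w * cosh w - sinh w) \<le> 44/100 * norm w ^ 3"
proof -
  let ?r = "norm w"
  have r2: "?r ^ 2 \<le> (51/100)^2" using w by (intro power_mono) auto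
  have E: "exp \<bar>Re w\<bar> \<le> 18/10" 
  proof -
    have "exp \<bar>Re w\<bar> \<le> 1 + \<bar>Re w\<bar> + \<bar>Re w\<bar>^2"
      using abs_Re_le_cmod[of w] w by (intro exp_bound) auto
    also have "\<dots> \<le> 1 + 51/100 + (51/100)^2"
      using abs_Re_le_cmod[of w] w by (intro add_mono power_mono) auto
    finally show ?thesis by (simp add: power2_eq_square)
  qed
  have s1: "norm (exp w - (\<Sum>k\<le>4. w ^ k / fact k)) \<le> exp \<bar>Re w\<bar> * ?r ^ 5 / 24"
    using Taylor_exp[of w 4] by (simp add: fact_numeral numeral_eq_Suc)
  have s2: "norm (exp (-w) - (\<Sum>k\<le>4. (-w) ^ k / fact k)) \<le> exp \<bar>Re w\<bar> * ?r ^ 5 / 24"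
    using Taylor_exp[of "-w" 4] by (simp add: fact_numeral numeral_eq_Suc)
  have c1: "norm (exp w - (\<Sum>k\<le>3. w ^ k / fact k)) \<le> exp \<bar>Re w\<bar> * ?r ^ 4 / 6"
    using Taylor_exp[of w 3] by (simp add: fact_numeral numeral_eq_Suc)
  have c2: "norm (exp (-w) - (\<Sum>k\<le>3. (-w) ^ k / fact k)) \<le> exp \<bar>Re w\<bar> * ?r ^ 4 / 6"
    using Taylor_exp[of "-w" 3] by (simp add: fact_numeral numeral_eq_Suc)
  \<comment> \<open>The even terms of the two exponentials cancel; for \<open>cosh\<close> below,
    the odd ones do.\<close>
  have "sinh w - w - w^3/6 = ((exp w - (\<Sum>k\<le>4. w ^ k / fact k)) - (exp (-w) - (\<Sum>k\<le>4. (-w) ^ k / fact k))) / 2"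
    by (simp add: sinh_field_def numeral_eq_Suc field_simps)
  hence "norm (sinh w - w - w^3/6) = norm ((exp w - (\<Sum>k\<le>4. w ^ k / fact k)) - (exp (-w) - (\<Sum>k\<le>4. (-w) ^ k / fact k))) / 2"
    by (simp only: norm_divide norm_numeral)
  also have "\<dots> \<le> exp \<bar>Re w\<bar> * ?r ^ 5 / 24"
    using norm_triangle_ineq4[of "exp w - (\<Sum>k\<le>4. w ^ k / fact k)" "exp (-w) - (\<Sum>k\<le>4. (-w) ^ k / fact k)"] s1 s2
    by linarith
  also have "\<dots> = (exp \<bar>Re w\<bar> * ?r^2 / 24) * ?r ^ 3" by (simp add: numeral_eq_Suc)
  also have "\<dots> \<le> ((18/10) * (51/100)^2 / 24) * ?r ^ 3"
    using E r2 by (intro mult_right_mono divide_right_mono mult_mono) auto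
  finally have S: "norm (sinh w - w - w^3/6) \<le> 2/100 * ?r^3"
    by (rule order_trans) (auto intro!: mult_right_mono simp: power2_eq_square)
  have "cosh w - 1 - w^2/2 = ((exp w - (\<Sum>k\<le>3. w ^ k / fact k)) + (exp (-w) - (\<Sum>k\<le>3. (-w) ^ k / fact k))) / 2"
    by (simp add: cosh_field_def numeral_eq_Suc field_simps)
  hence "norm (cosh w - 1 - w^2/2) = norm ((exp w - (\<Sum>k\<le>3. w ^ k / fact k)) + (exp (-w) - (\<Sum>k\<le>3. (-w) ^ k / fact k))) / 2"
    by (simp only: norm_divide norm_numeral)
  also have "\<dots> \<le> exp \<bar>Re w\<bar> * ?r ^ 4 / 6"
    using norm_triangle_ineq[of "exp w - (\<Sum>k\<le>3. w ^ k / fact k)" "exp (-w) - (\<Sum>k\<le>3. (-w) ^ k / fact k)"] c1 c2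
    by linarith
  also have "\<dots> = (exp \<bar>Re w\<bar> * ?r^2 / 6) * ?r ^ 2" by (simp add: numeral_eq_Suc)
  also have "\<dots> \<le> ((18/10) * (51/100)^2 / 6) * ?r ^ 2"
    using E r2 by (intro mult_right_mono divide_right_mono mult_mono) auto
  finally have C: "norm (cosh w - 1 - w^2/2) \<le> 8/100 * ?r^2"
    by (rule order_trans) (auto intro!: mult_right_mono simp: power2_eq_square)
  have "norm (sinh w - w) \<le> norm (sinh w - w - w^3/6) + norm (w^3/6)"
    using norm_triangle_ineq[of "sinh w - w - w^3/6" "w^3/6"] by simp
  also have "norm (w^3/6) = ?r^3/6" by (simp add: norm_divide norm_power)
  finally show "norm (sinh w - w) \<le> 19/100 * ?r ^ 3" using S zero_le_power[OF norm_ge_zero, of w 3] by linarith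
  have "w * cosh w - sinh w = w * (cosh w - 1 - w^2/2) - (sinh w - w - w^3/6) + w^3/3"
    by (simp add: field_simps numeral_eq_Suc)
  hence "norm (w * cosh w - sinh w) \<le> norm (w * (cosh w - 1 - w^2/2)) + norm (sinh w - w - w^3/6) + norm (w^3/3)"
    by (metis (no_types, lifting) norm_triangle_ineq norm_triangle_ineq4 add_right_mono order_trans)
  also have "norm (w * (cosh w - 1 - w^2/2)) \<le> ?r * (8/100 * ?r^2)"
    unfolding norm_mult using C by (intro mult_left_mono) auto
  also have "?r * (8/100 * ?r^2) = 8/100 * ?r^3" by (simp add: numeral_eq_Suc)
  also have "norm (w^3/3) = ?r^3/3" by (simp add: norm_divide norm_power)
  finally show "norm (w * cosh w - sinh w) \<le> 44/100 * norm w ^ 3"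
    using S zero_le_power[OF norm_ge_zero, of w 3] by linarith
qed

text \<open>The relative error of \<open>sinh w\<close> against \<open>w\<close> is at most
  \<open>19/100 * (51/100)^2\<close>, just below 5/100.\<close>

lemma norm_sinh_lower:
  fixes w :: complex
  assumes w: "norm w \<le> 51/100"
  shows "norm (sinh w) \<ge> 95/100 * norm w"
proof -
  have "norm w ^ 2 \<le> (51/100)^2" using w by (intro power_mono) auto
  hence "19/100 * norm w ^ 2 * norm w \<le> 5/100 * norm w"
    by (intro mult_right_mono) (auto simp: power2_eq_square)
  moreover have "norm (sinh w - w) \<le> 19/100 * norm w ^ 2 * norm w"
    using sinh_cosh_taylor_bounds(1)[OF w] by (simp add: numeral_eq_Suc)
  moreover have "norm w - norm (sinh w) \<le> norm (sinh w - w)"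
    by (metis norm_minus_commute norm_triangle_ineq2)
  ultimately show ?thesis by linarith
qed

lemma one_minus_exp_minus: "1 - exp (-z) = 2 * exp (-(z/2)) * sinh (z/2)" for z :: complex
  by (simp add: sinh_field_def field_simps flip: exp_add)

text \<open>With \<open>w = z / 2\<close> the kernel is half of coth w - 1/w, and behaves like
  \<open>z / 12\<close> near 0. The constant 15/100 is generous; sharing it with the Lipschitz bound
  lets one weight serve both.\<close>

lemma trap_kernel_bound:
  assumes z: "norm z \<le> 102/100" "z \<noteq> 0"
  shows "norm (trap_kernel z) \<le> 15/100 * norm z"
proof -
  define w where "w = z / 2"
  have zw: "z = 2 * w" by (simp add: w_def)
  have w: "norm w \<le> 51/100" "w \<noteq> 0" using z by (auto simp: w_def norm_divide)
  have sh: "norm (sinh w) \<ge> 95/100 * norm w" using norm_sinh_lower w by blast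
  hence s0: "sinh w \<noteq> 0" using w by (metis norm_eq_zero norm_le_zero_iff mult_le_0_iff not_numeral_le_zero zero_less_divide_iff linorder_not_le zero_less_numeral)
  have "1 / (1 - exp (-z)) = exp w / (2 * sinh w)"
    unfolding one_minus_exp_minus zw by (simp add: exp_minus field_simps)
  also have "exp w = sinh w + cosh w" by (simp add: sinh_plus_cosh)
  finally have "trap_kernel z = (w * cosh w - sinh w) / (2 * w * sinh w)"
    unfolding trap_kernel_def using s0 w by (simp add: zw add_divide_distrib diff_divide_distrib)
  hence "norm (trap_kernel z) = norm (w * cosh w - sinh w) / (2 * norm w * norm (sinh w))"
    by (simp add: norm_divide norm_mult)
  also have "\<dots> \<le> (44/100 * norm w ^ 3) / (2 * norm w * (95/100 * norm w))"
    using sinh_cosh_taylor_bounds(2)[OF w(1)] sh w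
    by (intro frac_le mult_left_mono mult_pos_pos) auto
  also have "\<dots> = 44/190 * norm w" using w by (simp add: field_simps numeral_eq_Suc)
  also have "\<dots> \<le> 15/100 * norm z" by (simp add: zw norm_mult)
  finally show ?thesis .
qed

text \<open>Mean value theorem on a convex set. The half plane keeps 0 out: there division by zero
  gives \<open>trap_kernel 0 = -1/2\<close>, not the limit 0.\<close>

lemma trap_kernel_lipschitz:
  assumes "norm x \<le> 102/100" "Re x > 0" "norm y \<le> 102/100" "Re y > 0"
  shows "norm (trap_kernel x - trap_kernel y) \<le> 15/100 * norm (x - y)"
proof (rule field_differentiable_bound[where S = "cball 0 (102/100) \<inter> {z. Re z > 0}" and
      f = trap_kernel and f' = "\<lambda>z. 1 / z^2 - exp (-z) / (1 - exp (-z))^2"])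
  show "convex (cball (0::complex) (102/100) \<inter> {z. Re z > 0})"
    by (intro convex_Int convex_cball convex_halfspace_Re_gt)
  fix z :: complex assume z': "z \<in> cball 0 (102/100) \<inter> {z. Re z > 0}"
  hence z: "norm z \<le> 102/100" "z \<noteq> 0" by auto
  define w where "w = z / 2"
  have zw: "z = 2 * w" by (simp add: w_def)
  have w: "norm w \<le> 51/100" "w \<noteq> 0" using z by (auto simp: w_def norm_divide)
  have sh: "norm (sinh w) \<ge> 95/100 * norm w" using norm_sinh_lower w by blast
  have "norm (sinh w) > 0" by (rule less_le_trans[OF _ sh]) (use w in auto)
  hence s0: "sinh w \<noteq> 0" by simp
  have e0: "1 - exp (-z) \<noteq> 0" unfolding one_minus_exp_minus using s0 by (simp add: w_def)
  show "(trap_kernel has_field_derivative 1 / z^2 - exp (-z) / (1 - exp (-z))^2)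
      (at z within cball 0 (102/100) \<inter> {z. Re z > 0})"
    unfolding trap_kernel_def using e0 z
    by (auto intro!: derivative_eq_intros simp: power2_eq_square)
  have "exp (-z) / (1 - exp (-z))^2 = 1 / (4 * sinh w ^ 2)"
  proof -
    have "exp (-z) = exp (-w) ^ 2" by (simp add: zw flip: exp_double)
    thus ?thesis unfolding one_minus_exp_minus zw by (simp add: power_mult_distrib)
  qed
  \<comment> \<open>Difference of squares, with \<open>sinh w + w\<close> written as
    \<open>2 * w + (sinh w - w)\<close> so that one Taylor bound controls both factors; the second
    is then at most \<open>(2 + 5/100) * norm w\<close>.\<close>
  moreover have "1 / z^2 - 1 / (4 * sinh w ^ 2) = (sinh w - w) * (2 * w + (sinh w - w)) / (4 * w^2 * sinh w ^ 2)"
    using s0 w by (simp add: zw field_simps power2_eq_square)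
  ultimately have "norm (1 / z^2 - exp (-z) / (1 - exp (-z))^2)
    = norm (sinh w - w) * norm (2 * w + (sinh w - w)) / (4 * norm w^2 * norm (sinh w) ^ 2)"
    by (simp add: norm_divide norm_mult norm_power)
  also have "\<dots> \<le> (19/100 * norm w ^ 3) * (205/100 * norm w) / (4 * norm w^2 * (95/100 * norm w)^2)"
  proof (intro frac_le mult_mono mult_left_mono power_mono)
    have "norm w ^ 2 \<le> (51/100)^2" using w by (intro power_mono) auto
    hence "19/100 * norm w ^ 2 * norm w \<le> 5/100 * norm w"
      by (intro mult_right_mono) (auto simp: power2_eq_square)
    moreover have "norm (sinh w - w) \<le> 19/100 * norm w ^ 2 * norm w"
      using sinh_cosh_taylor_bounds(1)[OF w(1)] by (simp add: numeral_eq_Suc)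
    moreover have "norm (2 * w + (sinh w - w)) \<le> 2 * norm w + norm (sinh w - w)"
      using norm_triangle_ineq[of "2*w" "sinh w - w"] by (simp add: norm_mult)
    ultimately show "norm (2 * w + (sinh w - w)) \<le> 205/100 * norm w" by linarith
  qed (use sinh_cosh_taylor_bounds(1)[OF w(1)] sh w in auto)
  also have "\<dots> \<le> 15/100" using w by (simp add: field_simps numeral_eq_Suc)
  finally show "norm (1 / z^2 - exp (-z) / (1 - exp (-z))^2) \<le> 15/100" .
qed (use assms in auto)

text \<open>The factors \<open>a\<close> may oscillate freely, since \<open>W\<close> dominates both
  \<open>r\<close> and its variation. Summation by parts gives
  \<open>A * W N + A * W M + A * (W N - W M)\<close>, in which \<open>W M\<close> cancels.\<close>

lemma abel_summation_bound:
  fixes a r :: "nat \<Rightarrow> 'a::real_normed_field" and W :: "nat \<Rightarrow> real"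
  assumes NM: "N \<le> M"
    and a: "\<And>n. n \<ge> N \<Longrightarrow> norm (a n) \<le> A"
    and r: "\<And>n. n \<ge> N \<Longrightarrow> norm (r n) \<le> W n"
    and dr: "\<And>n. n \<ge> N \<Longrightarrow> norm (r (Suc n) - r n) \<le> W n - W (Suc n)"
  shows "norm (\<Sum>n=N..<M. (a n - a (Suc n)) * r n) \<le> 2 * A * W N"
proof -
  have A: "A \<ge> 0" using a[of N] norm_ge_zero[of "a N"] by linarith
  have "(\<Sum>n=N..<M. (a n - a (Suc n)) * r n) =
      a N * r N - a M * r M + (\<Sum>n=N..<M. a (Suc n) * (r (Suc n) - r n))"
    using NM by (induction M rule: dec_induct) (auto simp: algebra_simps)
  also have "norm \<dots> \<le> norm (a N * r N) + norm (a M * r M) + norm (\<Sum>n=N..<M. a (Suc n) * (r (Suc n) - r n))"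
    by (meson norm_triangle_ineq norm_triangle_ineq4 add_right_mono order_trans)
  also have "norm (a N * r N) \<le> A * W N"
    unfolding norm_mult by (intro mult_mono a r A) auto
  also have "norm (a M * r M) \<le> A * W M"
    unfolding norm_mult using NM by (intro mult_mono a r A) auto
  also have "norm (\<Sum>n=N..<M. a (Suc n) * (r (Suc n) - r n)) \<le> (\<Sum>n=N..<M. A * (W n - W (Suc n)))"
    unfolding norm_mult by (intro sum_norm_le) (auto simp: norm_mult intro!: mult_mono a dr A)
  also have "\<dots> = A * (W N - W M)"
    using NM by (induction M rule: dec_induct) (auto simp: algebra_simps)
  finally show ?thesis by (simp add: algebra_simps)
qed

section \<open>Trapezoidal errors in the tail of the zeta function\<close>

lemma powr_minus_Suc:
  assumes "n \<ge> 1"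
  shows "1 / (of_nat (Suc n) :: complex) powr s = 1 / of_nat n powr s * exp (- (s * of_real (ln (1 + 1 / real n))))"
proof -
  have "ln (1 + 1 / real n) = ln (real (Suc n)) - ln (real n)"
    using assms ln_div[of "real (Suc n)" "real n"] by (simp add: add_divide_distrib add.commute)
  moreover have "(of_nat m :: complex) powr s = exp (s * of_real (ln (real m)))" if "m \<ge> 1" for m
    using that by (simp add: powr_def Ln_of_nat)
  ultimately show ?thesis using assms
    by (simp add: exp_minus exp_diff right_diff_distrib divide_inverse del: of_nat_Suc)
qed

text \<open>The left side is the trapezoidal value of one panel minus the exact integral of
  \<open>u powr (-s)\<close> from \<open>n\<close> to \<open>n + 1\<close>. Both are
  \<open>a n\<close> times expressions in the ratio \<open>q\<close> of consecutive terms; factoring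
  out \<open>a n - a (Suc n)\<close> leaves a combination of kernels.\<close>

lemma trapezoid_step:
  fixes s :: complex and a :: "nat \<Rightarrow> complex"
  assumes n: "n \<ge> 1" and s: "Re s > 0" "s \<noteq> 1"
  defines "a \<equiv> \<lambda>n. 1 / of_nat n powr s" and "L \<equiv> of_real (ln (1 + 1 / real n))"
  shows "(a n + a (Suc n)) / 2 - (of_nat n * a n - of_nat (Suc n) * a (Suc n)) / (s - 1)
       = (a n - a (Suc n)) * ((s * trap_kernel (s * L) - trap_kernel L) / (s - 1))"
proof -
  define q where "q = exp (- (s * L))"
  have L0: "ln (1 + 1 / real n) > 0" using n by (intro ln_gt_zero) auto
  have "norm q < 1" using L0 s unfolding q_def L_def by (simp add: norm_exp_eq_Re)
  hence q1: "1 - q \<noteq> 0" by auto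
  have s0: "s \<noteq> 0" "s - 1 \<noteq> 0" using s by auto
  have Ln0: "L \<noteq> 0" using L0 by (simp add: L_def)
  have aS: "a (Suc n) = a n * q"
    unfolding a_def q_def L_def by (rule powr_minus_Suc[OF n])
  \<comment> \<open>Since \<open>exp (-L) = n / (n + 1)\<close>, the kernel at \<open>L\<close> is
    explicit; its term \<open>1 / L\<close> cancels the one in
    \<open>s * trap_kernel (s * L)\<close>.\<close>
  have "exp (-L) = of_real (exp (- ln (1 + 1 / real n)))" by (simp add: L_def flip: exp_of_real)
  also have "exp (- ln (1 + 1 / real n)) = real n / (real n + 1)"
    using n by (simp add: exp_minus field_simps add_pos_pos)
  finally have "1 / (1 - exp (-L)) = of_real (1 / (1 - real n / (real n + 1)))" by simp
  also have "1 / (1 - real n / (real n + 1)) = real n + 1" using n by (simp add: field_simps)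
  finally have k1: "trap_kernel L = of_nat n + 1/2 - 1 / L" unfolding trap_kernel_def by simp
  have "s * trap_kernel (s * L) = s / (1 - q) - s / 2 - 1 / L"
    unfolding trap_kernel_def q_def using s0 Ln0 by (simp add: right_diff_distrib)
  hence "s * trap_kernel (s * L) - trap_kernel L = s / (1 - q) - s/2 - of_nat n - 1/2"
    using k1 by simp
  hence "(1 - q) * (s * trap_kernel (s * L) - trap_kernel L) = s - (1 - q) * (s / 2 + of_nat n + 1/2)"
    using q1 by (simp add: right_diff_distrib distrib_left)
  note kern = this
  have "(1 - q) * ((s * trap_kernel (s * L) - trap_kernel L) / (s - 1))
      = (1 + q) / 2 - (of_nat n - of_nat (Suc n) * q) / (s - 1)"
  proof -
    have "(1 + q) / 2 - (of_nat n - of_nat (Suc n) * q) / (s - 1)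
        = (s - (1 - q) * (s / 2 + of_nat n + 1/2)) / (s - 1)"
      using s0 by (simp add: divide_simps) (simp add: algebra_simps)
    with kern show ?thesis by (metis times_divide_eq_right)
  qed
  hence "a n * ((1 - q) * ((s * trap_kernel (s * L) - trap_kernel L) / (s - 1)))
      = a n * ((1 + q) / 2 - (of_nat n - of_nat (Suc n) * q) / (s - 1))" by simp
  thus ?thesis unfolding aS by (simp add: algebra_simps diff_divide_distrib add_divide_distrib)
qed

text \<open>Adding the panel identities leaves boundary terms and panel errors; Abel summation
  bounds the errors uniformly in \<open>M\<close>, and \<open>M\<close> tends to infinity. The
  assumption \<open>small\<close> keeps every \<open>s * L n\<close> with \<open>n \<ge> N\<close>
  in the disc of the kernel estimates.\<close>

lemma zeta_minus_partial_sum_bound: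
  fixes s :: complex
  assumes N: "N \<ge> 1" and s: "Re s > 0" "s \<noteq> 1"
    and small: "norm s * ln (1 + 1 / real N) \<le> 102/100"
  shows "norm (zeta s - (\<Sum>n=1..N. 1 / of_nat n powr s)) \<le>
    real N powr (- Re s) * (real N / norm (s - 1) + 1/2
       + 30/100 * ((norm s ^ 2 + 1) * ln (1 + 1 / real N) / norm (s - 1)))"
proof -
  define a :: "nat \<Rightarrow> complex" where "a = (\<lambda>n. 1 / of_nat n powr s)"
  define L where "L = (\<lambda>n::nat. ln (1 + 1 / real n))"
  define r where "r = (\<lambda>n. (s * trap_kernel (s * of_real (L n)) - trap_kernel (of_real (L n))) / (s - 1))"
  \<comment> \<open>Both kernel bounds are linear with the same constant, so
    \<open>W n - W (Suc n)\<close> bounds the variation of \<open>r\<close> just as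
    \<open>W n\<close> bounds its size.\<close>
  define W where "W = (\<lambda>n. 15/100 * ((norm s ^ 2 + 1) * L n / norm (s - 1)))"
  have s1: "norm (s - 1) > 0" using s by simp
  have L0: "L n > 0" if "n \<ge> N" for n using that N unfolding L_def by (intro ln_gt_zero) auto
  have Lmono: "L n \<le> L m" if "n \<ge> m" "m \<ge> N" for m n
    using that N unfolding L_def by (simp add: frac_le add_pos_pos)
  have L1: "L n \<le> 1" if "n \<ge> N" for n
  proof -
    have "L n \<le> 1 / real n" unfolding L_def by (rule ln_add_one_self_le_self) auto
    also have "\<dots> \<le> 1" using that N by simp
    finally show ?thesis .
  qed
  have sL: "norm (s * of_real (L n)) \<le> 102/100" if n: "n \<ge> N" for n
  proof -
    have "norm (s * of_real (L n)) = norm s * L n" using L0[OF n] by (simp add: norm_mult)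
    also have "\<dots> \<le> norm s * L N" using Lmono[OF n] by (intro mult_left_mono) auto
    finally show ?thesis using small by (simp add: L_def)
  qed
  have an: "norm (a n) \<le> real N powr (- Re s)" if n: "n \<ge> N" for n
  proof -
    have "norm (a n) = real n powr (- Re s)"
      using n N by (simp add: a_def norm_divide norm_nat_powr powr_minus field_simps)
    also have "\<dots> \<le> real N powr (- Re s)" using n N s by (intro powr_mono2') auto
    finally show ?thesis .
  qed
  have rn: "norm (r n) \<le> W n" if n: "n \<ge> N" for n
  proof -
    have "norm (s * trap_kernel (s * of_real (L n)) - trap_kernel (of_real (L n)))
      \<le> norm (s * trap_kernel (s * of_real (L n))) + norm (trap_kernel (of_real (L n)))"
      by (rule norm_triangle_ineq4)
    also have "norm (s * trap_kernel (s * of_real (L n))) \<le> norm s * (15/100 * norm (s * of_real (L n)))"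
      unfolding norm_mult[of s "trap_kernel _"] using sL[OF n] L0[OF n] s
      by (intro mult_left_mono trap_kernel_bound) auto
    also have "norm (trap_kernel (of_real (L n))) \<le> 15/100 * norm (of_real (L n) :: complex)"
      using L0[OF n] L1[OF n] by (intro trap_kernel_bound) auto
    finally have "norm (s * trap_kernel (s * of_real (L n)) - trap_kernel (of_real (L n)))
      \<le> 15/100 * ((norm s ^ 2 + 1) * L n)"
      using L0[OF n] by (simp add: norm_mult algebra_simps power2_eq_square)
    thus ?thesis unfolding r_def W_def using s1 by (simp add: norm_divide divide_right_mono field_simps)
  qed
  have dr: "norm (r (Suc n) - r n) \<le> W n - W (Suc n)" if n: "n \<ge> N" for n
  proof -
    have n': "Suc n \<ge> N" using n by simp
    have Ld: "norm (of_real (L (Suc n)) - of_real (L n) :: complex) = L n - L (Suc n)"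
      using Lmono[of n "Suc n"] n by (simp flip: of_real_diff)
    have "norm ((s * trap_kernel (s * of_real (L (Suc n))) - trap_kernel (of_real (L (Suc n))))
         - (s * trap_kernel (s * of_real (L n)) - trap_kernel (of_real (L n))))
      = norm (s * (trap_kernel (s * of_real (L (Suc n))) - trap_kernel (s * of_real (L n)))
         - (trap_kernel (of_real (L (Suc n))) - trap_kernel (of_real (L n))))"
      by (simp add: algebra_simps)
    also have "\<dots> \<le> norm (s * (trap_kernel (s * of_real (L (Suc n))) - trap_kernel (s * of_real (L n))))
       + norm (trap_kernel (of_real (L (Suc n))) - trap_kernel (of_real (L n)))"
      by (rule norm_triangle_ineq4)
    also have "\<dots> \<le> norm s * (15/100 * (norm s * (L n - L (Suc n)))) + 15/100 * (L n - L (Suc n))"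
    proof (rule add_mono)
      have "norm (s * (trap_kernel (s * of_real (L (Suc n))) - trap_kernel (s * of_real (L n))))
         \<le> norm s * (15/100 * norm (s * of_real (L (Suc n)) - s * of_real (L n)))"
        unfolding norm_mult[of s "_ - _"] using sL[OF n] sL[OF n'] L0[OF n] L0[OF n'] s
        by (intro mult_left_mono trap_kernel_lipschitz) auto
      also have "norm (s * of_real (L (Suc n)) - s * of_real (L n)) = norm s * (L n - L (Suc n))"
        unfolding right_diff_distrib[symmetric] norm_mult Ld ..
      finally show "norm (s * (trap_kernel (s * of_real (L (Suc n))) - trap_kernel (s * of_real (L n))))
         \<le> norm s * (15/100 * (norm s * (L n - L (Suc n))))" .
      show "norm (trap_kernel (of_real (L (Suc n))) - trap_kernel (of_real (L n))) \<le> 15/100 * (L n - L (Suc n))"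
        unfolding Ld[symmetric] using L0[OF n] L1[OF n] L0[OF n'] L1[OF n']
        by (intro trap_kernel_lipschitz) auto
    qed
    also have "norm s * (15/100 * (norm s * (L n - L (Suc n)))) + 15/100 * (L n - L (Suc n))
       = 15/100 * ((norm s ^ 2 + 1) * (L n - L (Suc n)))"
      unfolding power2_eq_square by algebra
    finally have "norm ((s * trap_kernel (s * of_real (L (Suc n))) - trap_kernel (of_real (L (Suc n))))
         - (s * trap_kernel (s * of_real (L n)) - trap_kernel (of_real (L n))))
       \<le> 15/100 * ((norm s ^ 2 + 1) * (L n - L (Suc n)))" (is "?l \<le> ?u") .
    hence "?l / norm (s - 1) \<le> ?u / norm (s - 1)" using s1 by (intro divide_right_mono) auto
    moreover have "norm (r (Suc n) - r n) = ?l / norm (s - 1)"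
      unfolding r_def diff_divide_distrib[symmetric] norm_divide ..
    moreover have "?u / norm (s - 1) = W n - W (Suc n)"
      unfolding W_def by (simp add: algebra_simps diff_divide_distrib add_divide_distrib)
    ultimately show ?thesis by simp
  qed
  \<comment> \<open>Each term strictly between \<open>N\<close> and \<open>M\<close> receives a half
    from both neighbouring panels; only the halves at the two ends stay unpaired.\<close>
  have za: "zeta_approx M s - (\<Sum>n=1..N. a n) = of_nat N * a N / (s - 1) - a N / 2 + a M / 2
      + (\<Sum>n=N..<M. (a n - a (Suc n)) * r n)" if "M \<ge> N" for M
    using that
  proof (induction M rule: dec_induct)
    case base
    have "of_nat N powr (1 - s) = of_nat N * a N"
      using N by (simp add: a_def powr_diff)
    hence "zeta_approx N s - (\<Sum>n=1..N. a n) = - (of_nat N * a N / (1 - s))"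
      by (simp add: zeta_approx_def a_def)
    also have "\<dots> = of_nat N * a N / (s - 1)"
      by (metis minus_diff_eq minus_divide_right)
    finally show ?case by simp
  next
    case (step M)
    have M: "M \<ge> 1" using step N by simp
    have p: "of_nat m powr (1 - s) = of_nat m * a m" if "m \<ge> 1" for m
      using that by (simp add: a_def powr_diff)
    have st: "(a M - a (Suc M)) * r M = (a M + a (Suc M)) / 2 - (of_nat M * a M - of_nat (Suc M) * a (Suc M)) / (s - 1)"
      unfolding a_def r_def L_def using trapezoid_step[OF M s] by simp
    have d: "zeta_approx (Suc M) s - zeta_approx M s = a (Suc M) - (of_nat (Suc M) * a (Suc M) - of_nat M * a M) / (1 - s)"
      unfolding zeta_approx_def using p[of M] p[of "Suc M"] M
      by (simp add: a_def diff_divide_distrib del: of_nat_Suc)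
    have "(of_nat (Suc M) * a (Suc M) - of_nat M * a M) / (1 - s) = (of_nat M * a M - of_nat (Suc M) * a (Suc M)) / (s - 1)"
      by (metis minus_diff_eq minus_divide_divide)
    with d st have "zeta_approx (Suc M) s - zeta_approx M s = (a M - a (Suc M)) * r M - a M / 2 + a (Suc M) / 2"
      by (simp add: add_divide_distrib)
    hence zS: "zeta_approx (Suc M) s = zeta_approx M s + ((a M - a (Suc M)) * r M - a M / 2 + a (Suc M) / 2)"
      by (simp only: diff_eq_eq add.commute)
    have zM: "zeta_approx M s = of_nat N * a N / (s - 1) - a N / 2 + a M / 2
        + (\<Sum>n=N..<M. (a n - a (Suc n)) * r n) + (\<Sum>n=1..N. a n)"
      using step.IH by (simp only: diff_eq_eq)
    have "(\<Sum>n=N..<Suc M. (a n - a (Suc n)) * r n) = (\<Sum>n=N..<M. (a n - a (Suc n)) * r n) + (a M - a (Suc M)) * r M"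
      using step.hyps by simp
    thus ?case unfolding zS zM by simp
  qed
  let ?A = "real N powr (- Re s)"
  have bd: "norm (zeta_approx M s - (\<Sum>n=1..N. a n)) \<le> ?A * (real N / norm (s - 1) + 1/2 + 2 * W N) + real M powr (- Re s)"
    if M: "M \<ge> N" for M
  proof -
    have "norm (zeta_approx M s - (\<Sum>n=1..N. a n)) \<le> norm (of_nat N * a N / (s - 1)) + norm (a N / 2) + norm (a M / 2)
      + norm (\<Sum>n=N..<M. (a n - a (Suc n)) * r n)"
      unfolding za[OF M] 
      by (meson norm_triangle_ineq norm_triangle_ineq4 add_right_mono order_trans)
    also have "norm (of_nat N * a N / (s - 1)) \<le> ?A * (real N / norm (s - 1))"
      using mult_left_mono[OF an[of N], of "real N / norm (s - 1)"] s1 by (simp add: norm_divide norm_mult mult.commute)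
    also have "norm (a N / 2) \<le> ?A * (1/2)" using an[of N] by (simp add: norm_divide)
    also have "norm (a M / 2) \<le> real M powr (- Re s)"
      using M N by (simp add: a_def norm_divide norm_nat_powr powr_minus field_simps)
    also have "norm (\<Sum>n=N..<M. (a n - a (Suc n)) * r n) \<le> 2 * ?A * W N"
      by (rule abel_summation_bound) (use M an rn dr in auto)
    finally show ?thesis by (simp add: algebra_simps)
  qed
  have "(\<lambda>M. norm (zeta_approx M s - (\<Sum>n=1..N. a n))) \<longlonglongrightarrow> norm (zeta s - (\<Sum>n=1..N. a n))"
    by (intro tendsto_norm tendsto_diff tendsto_const tendsto_zeta_approx s)
  moreover have "(\<lambda>M. ?A * (real N / norm (s - 1) + 1/2 + 2 * W N) + real M powr (- Re s))
      \<longlonglongrightarrow> ?A * (real N / norm (s - 1) + 1/2 + 2 * W N) + 0"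
    using s by (intro tendsto_add tendsto_const tendsto_neg_powr filterlim_real_sequentially) auto
  ultimately have "norm (zeta s - (\<Sum>n=1..N. a n)) \<le> ?A * (real N / norm (s - 1) + 1/2 + 2 * W N) + 0"
    using bd by (intro tendsto_le[OF sequentially_bot]) (auto simp: eventually_sequentially)
  moreover have "2 * W N = 30/100 * ((norm s ^ 2 + 1) * ln (1 + 1 / real N) / norm (s - 1))"
    by (simp add: W_def L_def)
  ultimately show ?thesis unfolding a_def by (simp only: add_0_right)
qed

text \<open>The integral, the half term and the panel errors contribute at most 1, 1/2 and
  \<open>30/100 * 2\<close>. The factor 1001/1000 for replacing \<open>N\<close> by \<open>t\<close>
  makes this 2.1021, below \<open>c0\<close>.\<close>

lemma zeta_approximation:
  assumes \<sigma>: "0 < \<sigma>" "\<sigma> \<le> 1" and t: "t \<ge> 10^3"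
  shows "norm (zeta (Complex \<sigma> t) - (\<Sum>n=1..nat \<lfloor>t\<rfloor>. 1 / of_nat n powr Complex \<sigma> t)) \<le> c0 * t powr (-\<sigma>)"
proof -
  define N where "N = nat \<lfloor>t\<rfloor>"
  define s where "s = Complex \<sigma> t"
  have Nt: "real N \<le> t" "t < real N + 1" "real N \<ge> 1000"
  proof -
    have "\<lfloor>t\<rfloor> \<ge> 1000" using t by (simp add: le_floor_iff)
    hence "real N = of_int \<lfloor>t\<rfloor>" "(1000::real) \<le> of_int \<lfloor>t\<rfloor>" unfolding N_def by simp_all
    thus "real N \<le> t" "t < real N + 1" "real N \<ge> 1000" by linarith+
  qed
  have N1: "N \<ge> 1" using Nt by simp
  have s: "Re s > 0" "s \<noteq> 1" using \<sigma> t by (auto simp: s_def complex_eq_iff)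
  have st: "norm s \<le> t + 1" using cmod_le[of s] \<sigma> t by (simp add: s_def)
  have s1: "norm (s - 1) \<ge> t" using abs_Im_le_cmod[of "s - 1"] t by (simp add: s_def)
  have L: "ln (1 + 1 / real N) \<le> 1 / real N" by (rule ln_add_one_self_le_self) auto
  have L0: "ln (1 + 1 / real N) \<ge> 0" by simp
  have "norm s * ln (1 + 1 / real N) \<le> (t + 1) * (1 / real N)"
    using st L L0 t by (intro mult_mono) auto
  \<comment> \<open>From \<open>t + 1 < N + 2\<close> and \<open>N \<ge> 1000\<close>; this is below
    the 102/100 required by the kernel estimates.\<close>
  also have "\<dots> \<le> 1002/1000" using Nt by (simp add: field_simps)
  finally have sL: "norm s * ln (1 + 1 / real N) \<le> 1002/1000" .
  have "norm (zeta s - (\<Sum>n=1..N. 1 / of_nat n powr s)) \<le>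
    real N powr (- Re s) * (real N / norm (s - 1) + 1/2
       + 30/100 * ((norm s ^ 2 + 1) * ln (1 + 1 / real N) / norm (s - 1)))"
    by (rule zeta_minus_partial_sum_bound[OF N1 s]) (use sL in simp)
  also have "\<dots> \<le> (1001/1000 * t powr (-\<sigma>)) * (1 + 1/2 + 30/100 * 2)"
  proof (intro mult_mono add_mono mult_left_mono)
    show "real N / norm (s - 1) \<le> 1" using s1 Nt by (simp add: divide_le_eq)
    have "(norm s ^ 2 + 1) * ln (1 + 1 / real N) = norm s * (norm s * ln (1 + 1 / real N)) + ln (1 + 1 / real N)"
      by (simp add: algebra_simps power2_eq_square)
    also have "\<dots> \<le> (t + 1) * (1002/1000) + 1 / real N"
      using st sL L L0 t by (intro add_mono mult_mono) auto
    also have "\<dots> \<le> (t + 1) * (1002/1000) + 1" using Nt by simp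
    also have "\<dots> \<le> 2 * t" using t by (simp add: field_simps)
    also have "\<dots> \<le> 2 * norm (s - 1)" using s1 by simp
    finally show "(norm s ^ 2 + 1) * ln (1 + 1 / real N) / norm (s - 1) \<le> 2"
      using s1 t by (simp add: divide_le_eq)
    have "real N powr (-\<sigma>) = (t / real N) powr \<sigma> * t powr (-\<sigma>)"
      using Nt by (simp add: powr_divide powr_minus field_simps)
    also have "(t / real N) powr \<sigma> \<le> (t / real N) powr 1"
      using Nt \<sigma> by (intro powr_mono) auto
    also have "\<dots> \<le> 1001/1000" using Nt by (simp add: field_simps)
    finally show "real N powr (- Re s) \<le> 1001/1000 * t powr (-\<sigma>)"
      by (simp add: s_def mult_right_mono)
  qed (use L0 in auto)
  also have "\<dots> \<le> c0 * t powr (-\<sigma>)" by (simp add: c0_def)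
  finally show ?thesis unfolding N_def s_def .
qed

section \<open>Mean square of the partial sums\<close>

lemma sum_symmetric:
  fixes g :: "nat \<Rightarrow> nat \<Rightarrow> 'a::comm_semiring_1"
  assumes "\<And>n m. g n m = g m n"
  shows "(\<Sum>n=1..N. \<Sum>m=1..N. g n m) = (\<Sum>n=1..N. g n n) + 2 * (\<Sum>m=1..N. \<Sum>n=1..<m. g n m)"
proof (induction N)
  case (Suc N)
  have "(\<Sum>n=1..N. g (Suc N) n) = (\<Sum>n=1..N. g n (Suc N))" using assms by (intro sum.cong) auto
  thus ?case using Suc
    by (simp add: sum.distrib atLeastLessThanSuc_atLeastAtMost algebra_simps mult_2)
qed simp

text \<open>The length of the sum depends on \<open>t\<close>. Moving this into the condition
  \<open>max n m \<le> t\<close> gives a double sum over a fixed range, which can be integrated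
  termwise.\<close>

lemma norm_sq_dirichlet_polynomial:
  fixes \<sigma> t :: real
  assumes "t \<ge> 0" "t \<le> T"
  shows "norm (\<Sum>n=1..nat \<lfloor>t\<rfloor>. 1 / (of_nat n :: complex) powr Complex \<sigma> t) ^ 2 =
    (\<Sum>n=1..nat \<lfloor>T\<rfloor>. \<Sum>m=1..nat \<lfloor>T\<rfloor>. if real (max n m) \<le> t
        then real n powr (-\<sigma>) * real m powr (-\<sigma>) * cos (t * (ln (real n) - ln (real m))) else 0)"
proof -
  define N where "N = nat \<lfloor>T\<rfloor>"
  define b where "b = (\<lambda>n. if real n \<le> t then real n powr (-\<sigma>) else 0)"
  have sub: "nat \<lfloor>t\<rfloor> \<le> N" unfolding N_def using assms by (intro nat_mono floor_mono)
  have lei: "n \<le> nat \<lfloor>t\<rfloor> \<longleftrightarrow> real n \<le> t" for n using assms by (simp add: le_nat_iff le_floor_iff)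
  have pw: "1 / (of_nat n :: complex) powr Complex \<sigma> t = Complex (real n powr (-\<sigma>) * cos (t * ln (real n))) (- (real n powr (-\<sigma>) * sin (t * ln (real n))))"
    if "n \<ge> 1" for n
  proof -
    have "1 / (of_nat n :: complex) powr Complex \<sigma> t = exp (- (Complex \<sigma> t * of_real (ln (real n))))"
      using that by (simp add: powr_def Ln_of_nat exp_minus divide_inverse)
    thus ?thesis using that
      by (simp add: complex_eq_iff Re_exp Im_exp powr_def mult.commute)
  qed
  have "(\<Sum>n=1..nat \<lfloor>t\<rfloor>. 1 / (of_nat n :: complex) powr Complex \<sigma> t)
     = (\<Sum>n=1..N. Complex (b n * cos (t * ln (real n))) (- (b n * sin (t * ln (real n)))))"
    using sub by (intro sum.mono_neutral_cong_left) (auto simp: pw b_def lei zero_complex.code)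
  also have "\<dots> = Complex (\<Sum>n=1..N. b n * cos (t * ln (real n))) (- (\<Sum>n=1..N. b n * sin (t * ln (real n))))"
    by (simp add: complex_eq_iff sum_negf)
  finally have "norm (\<Sum>n=1..nat \<lfloor>t\<rfloor>. 1 / (of_nat n :: complex) powr Complex \<sigma> t) ^ 2
     = (\<Sum>n=1..N. b n * cos (t * ln (real n)))^2 + (\<Sum>n=1..N. b n * sin (t * ln (real n)))^2"
    by (simp add: cmod_power2)
  also have "\<dots> = (\<Sum>n=1..N. \<Sum>m=1..N. b n * b m * cos (t * (ln (real n) - ln (real m))))"
    unfolding power2_eq_square sum_product sum.distrib[symmetric]
    by (intro sum.cong refl) (simp add: right_diff_distrib cos_diff algebra_simps)
  also have "\<dots> = (\<Sum>n=1..N. \<Sum>m=1..N. if real (max n m) \<le> t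
        then real n powr (-\<sigma>) * real m powr (-\<sigma>) * cos (t * (ln (real n) - ln (real m))) else 0)"
    by (intro sum.cong refl) (auto simp: b_def)
  finally show ?thesis unfolding N_def .
qed

text \<open>The integral effectively starts at \<open>max H a\<close>, and
  \<open>sin (t * d) / d\<close> varies by at most \<open>2 / \<bar>d\<bar>\<close>; the case
  \<open>d = 0\<close> is the diagonal.\<close>

lemma integral_cos_truncated:
  fixes a H T c d :: real
  assumes "H \<le> T" "a \<le> T" "c \<ge> 0"
  shows "(\<lambda>t. if a \<le> t then c * cos (t * d) else 0) integrable_on {H..T}"
    and "integral {H..T} (\<lambda>t. if a \<le> t then c * cos (t * d) else 0) \<le> (if d = 0 then c * (T - H) else c * (2 / \<bar>d\<bar>))"
proof -
  define l where "l = max H a"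
  have l: "l \<le> T" "H \<le> l" using assms by (auto simp: l_def)
  define I where "I = (if d = 0 then c * (T - l) else c * ((sin (T * d) - sin (l * d)) / d))"
  have "((\<lambda>t. c * cos (t * d)) has_integral I) {l..T}"
  proof (cases "d = 0")
    case True
    thus ?thesis using has_integral_const_real[of c l T] l by (simp add: I_def mult.commute)
  next
    case False
    have "((\<lambda>t. c * cos (t * d)) has_integral (c * (sin (T * d) / d) - c * (sin (l * d) / d))) {l..T}"
      using False l by (intro fundamental_theorem_of_calculus)
        (auto intro!: derivative_eq_intros simp flip: has_real_derivative_iff_has_vector_derivative)
    thus ?thesis using False by (simp add: I_def right_diff_distrib diff_divide_distrib)
  qed
  hence "((\<lambda>t. if t \<in> {l..T} then c * cos (t * d) else 0) has_integral I) {H..T}"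
    using l by (subst has_integral_restrict) auto
  hence I: "((\<lambda>t. if a \<le> t then c * cos (t * d) else 0) has_integral I) {H..T}"
    by (rule has_integral_eq[rotated]) (auto simp: l_def)
  thus "(\<lambda>t. if a \<le> t then c * cos (t * d) else 0) integrable_on {H..T}" by blast
  have "integral {H..T} (\<lambda>t. if a \<le> t then c * cos (t * d) else 0) = I" using I by (rule integral_unique)
  also have "I \<le> (if d = 0 then c * (T - H) else c * (2 / \<bar>d\<bar>))"
  proof (cases "d = 0")
    case True thus ?thesis using l assms by (auto simp: I_def intro!: mult_left_mono)
  next
    case False
    have "\<bar>sin (T * d) - sin (l * d)\<bar> \<le> 2"
      using sin_ge_minus_one[of "T*d"] sin_le_one[of "T*d"] sin_ge_minus_one[of "l*d"] sin_le_one[of "l*d"] by linarith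
    hence "\<bar>(sin (T * d) - sin (l * d)) / d\<bar> \<le> 2 / \<bar>d\<bar>" unfolding abs_divide by (intro divide_right_mono) auto
    hence "(sin (T * d) - sin (l * d)) / d \<le> 2 / \<bar>d\<bar>" by linarith
    hence "c * ((sin (T * d) - sin (l * d)) / d) \<le> c * (2 / \<bar>d\<bar>)" using assms(3) by (rule mult_left_mono)
    thus ?thesis using False by (simp add: I_def)
  qed
  finally show "integral {H..T} (\<lambda>t. if a \<le> t then c * cos (t * d) else 0) \<le> (if d = 0 then c * (T - H) else c * (2 / \<bar>d\<bar>))" .
qed

text \<open>The factor 4 is the 2 of the oscillating integral times the 2 from counting each pair in
  both orders.\<close>

lemma dirichlet_polynomial_mean_square:
  fixes \<sigma> H T :: real
  assumes HT: "0 \<le> H" "H \<le> T"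
  defines "S \<equiv> \<lambda>t. norm (\<Sum>n=1..nat \<lfloor>t\<rfloor>. 1 / (of_nat n :: complex) powr Complex \<sigma> t) ^ 2"
  shows "S integrable_on {H..T}"
    and "integral {H..T} S \<le> (T - H) * (\<Sum>n=1..nat \<lfloor>T\<rfloor>. real n powr (-2*\<sigma>))
       + 4 * (\<Sum>m=1..nat \<lfloor>T\<rfloor>. \<Sum>n=1..<m. real n powr (-\<sigma>) * real m powr (-\<sigma>) / (ln (real m) - ln (real n)))"
proof -
  define N where "N = nat \<lfloor>T\<rfloor>"
  define c where "c = (\<lambda>n m. real n powr (-\<sigma>) * real m powr (-\<sigma>))"
  define d where "d = (\<lambda>n m. ln (real n) - ln (real m))"
  define f where "f = (\<lambda>n m t. if real (max n m) \<le> t then c n m * cos (t * d n m) else 0)"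
  define B where "B = (\<lambda>n m. if d n m = 0 then c n m * (T - H) else c n m * (2 / \<bar>d n m\<bar>))"
  have S: "S t = (\<Sum>n=1..N. \<Sum>m=1..N. f n m t)" if "t \<in> {H..T}" for t
    unfolding S_def f_def c_def d_def N_def using that HT by (intro norm_sq_dirichlet_polynomial) auto
  have NT: "real (max n m) \<le> T" if "n \<in> {1..N}" "m \<in> {1..N}" for n m
  proof -
    have "real N \<le> T" using HT unfolding N_def by simp
    thus ?thesis using that by (auto simp: max_def)
  qed
  have f: "f n m integrable_on {H..T}" "integral {H..T} (f n m) \<le> B n m" if "n \<in> {1..N}" "m \<in> {1..N}" for n m
    unfolding f_def B_def
    by (rule integral_cos_truncated[OF HT(2) NT[OF that]], simp add: c_def)+
  have int: "(\<lambda>t. \<Sum>n=1..N. \<Sum>m=1..N. f n m t) integrable_on {H..T}"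
    by (intro integrable_sum f) auto
  show "S integrable_on {H..T}" using int by (rule integrable_eq) (simp add: S)
  have "integral {H..T} S = integral {H..T} (\<lambda>t. \<Sum>n=1..N. \<Sum>m=1..N. f n m t)"
    by (rule integral_cong) (simp add: S)
  also have "\<dots> = (\<Sum>n=1..N. \<Sum>m=1..N. integral {H..T} (f n m))"
    by (intro integral_unique has_integral_sum integrable_integral f) auto
  also have "\<dots> \<le> (\<Sum>n=1..N. \<Sum>m=1..N. B n m)" by (intro sum_mono f)
  also have "\<dots> = (\<Sum>n=1..N. B n n) + 2 * (\<Sum>m=1..N. \<Sum>n=1..<m. B n m)"
    by (rule sum_symmetric) (auto simp: B_def c_def d_def abs_minus_commute)
  also have "(\<Sum>n=1..N. B n n) = (T - H) * (\<Sum>n=1..N. real n powr (-2*\<sigma>))"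
    unfolding sum_distrib_left by (intro sum.cong refl) (auto simp: B_def d_def c_def simp flip: powr_add)
  also have "(\<Sum>m=1..N. \<Sum>n=1..<m. B n m) = 2 * (\<Sum>m=1..N. \<Sum>n=1..<m. c n m / (ln (real m) - ln (real n)))"
    unfolding sum_distrib_left by (intro sum.cong refl) (auto simp: B_def d_def)
  finally show "integral {H..T} S \<le> (T - H) * (\<Sum>n=1..nat \<lfloor>T\<rfloor>. real n powr (-2*\<sigma>))
       + 4 * (\<Sum>m=1..nat \<lfloor>T\<rfloor>. \<Sum>n=1..<m. real n powr (-\<sigma>) * real m powr (-\<sigma>) / (ln (real m) - ln (real n)))"
    unfolding N_def c_def by simp
qed

section \<open>Comparison of power sums with integrals\<close>

lemma powr_step:
  fixes c x :: real
  assumes "x > 0" "c > 0" "c \<noteq> 1"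
  shows "(x + 1) powr (-c) \<le> ((x + 1) powr (1 - c) - x powr (1 - c)) / (1 - c)"
proof -
  have "\<exists>z>x. z < x + 1 \<and> (x + 1) powr (1 - c) / (1 - c) - x powr (1 - c) / (1 - c) = (x + 1 - x) * z powr (-c)"
    using assms by (intro MVT2) (auto intro!: derivative_eq_intros)
  then obtain z where z: "z > x" "z < x + 1"
    "(x + 1) powr (1 - c) / (1 - c) - x powr (1 - c) / (1 - c) = z powr (-c)" by auto
  have "(x + 1) powr (-c) \<le> z powr (-c)" using z assms by (intro powr_mono2') auto
  thus ?thesis using z by (simp add: diff_divide_distrib)
qed

lemma sum_powr_diff_le:
  fixes c :: real
  assumes c: "c > 0" "c \<noteq> 1" and N: "1 \<le> N" "N \<le> M"
  shows "(\<Sum>n=1..M. real n powr (-c)) \<le> (\<Sum>n=1..N. real n powr (-c)) + (real M powr (1 - c) - real N powr (1 - c)) / (1 - c)"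
  using N(2)
proof (induction M rule: dec_induct)
  case (step M)
  have "real (Suc M) powr (-c) \<le> (real (Suc M) powr (1 - c) - real M powr (1 - c)) / (1 - c)"
    using powr_step[of "real M" c] c step N by (simp add: add.commute)
  thus ?case using step by (simp add: diff_divide_distrib)
qed simp

text \<open>Keeping the first term exact puts \<open>- c\<close> into the numerator; these constants
  become the negative terms of \<open>eps1\<close>.\<close>

lemma sum_powr_le:
  fixes c x :: real
  assumes c: "0 < c" "c < 1" and N: "1 \<le> N" "real N \<le> x"
  shows "(\<Sum>n=1..N. real n powr (-c)) \<le> (x powr (1 - c) - c) / (1 - c)"
proof -
  have "(\<Sum>n=1..N. real n powr (-c)) \<le> 1 + (real N powr (1 - c) - 1) / (1 - c)"
    using sum_powr_diff_le[of c 1 N] c N by simp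
  also have "\<dots> = (real N powr (1 - c) - c) / (1 - c)" using c by (simp add: field_simps)
  also have "\<dots> \<le> (x powr (1 - c) - c) / (1 - c)"
    using c N by (intro divide_right_mono diff_right_mono powr_mono2) auto
  finally show ?thesis .
qed

text \<open>The term at \<open>Suc N \<ge> T\<close> is kept apart, and those after it are compared
  with an integral starting at \<open>Suc N\<close>. Read as a lower bound for the partial sum, this
  gives the last two terms of \<open>eps1\<close>.\<close>

lemma zr_le_partial_sum:
  fixes c T :: real
  assumes c: "c > 1" and T: "T \<ge> 1"
  shows "zr c \<le> (\<Sum>n=1..nat \<lfloor>T\<rfloor>. real n powr (-c)) + T powr (-c) + T powr (1 - c) / (c - 1)"
proof -
  define N where "N = nat \<lfloor>T\<rfloor>"
  have NT: "T \<le> real (Suc N)" unfolding N_def using T by linarith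
  let ?U = "(\<Sum>n=1..N. real n powr (-c)) + T powr (-c) + T powr (1 - c) / (c - 1)"
  have "(\<Sum>k<M. real (Suc k) powr (-c)) \<le> ?U" if M: "M \<ge> Suc N" for M
  proof -
    have "(\<Sum>k<M. real (Suc k) powr (-c)) = (\<Sum>n=1..M. real n powr (-c))"
      by (rule sum.reindex_bij_witness[of _ "\<lambda>k. k - 1" Suc]) auto
    also have "\<dots> \<le> (\<Sum>n=1..Suc N. real n powr (-c)) + (real M powr (1 - c) - real (Suc N) powr (1 - c)) / (1 - c)"
      using sum_powr_diff_le[of c "Suc N" M] c M by simp
    also have "(real M powr (1 - c) - real (Suc N) powr (1 - c)) / (1 - c) = (real (Suc N) powr (1 - c) - real M powr (1 - c)) / (c - 1)"
      by (metis minus_diff_eq minus_divide_divide)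
    also have "\<dots> \<le> T powr (1 - c) / (c - 1)"
    proof (rule divide_right_mono)
      have "real (Suc N) powr (1 - c) \<le> T powr (1 - c)" using NT T c by (intro powr_mono2') auto
      thus "real (Suc N) powr (1 - c) - real M powr (1 - c) \<le> T powr (1 - c)"
        using powr_ge_zero[of "real M" "1 - c"] by linarith
    qed (use c in auto)
    also have "(\<Sum>n=1..Suc N. real n powr (-c)) \<le> (\<Sum>n=1..N. real n powr (-c)) + T powr (-c)"
    proof -
      have "real (Suc N) powr (-c) \<le> T powr (-c)" using NT T c by (intro powr_mono2') auto
      thus ?thesis by simp
    qed
    finally show ?thesis by simp
  qed
  moreover have "(\<lambda>M. \<Sum>k<M. real (Suc k) powr (-c)) \<longlonglongrightarrow> zr c"
    using zeta_real_sums[OF c] unfolding sums_def .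
  ultimately show ?thesis unfolding N_def by (intro LIMSEQ_le_const2) blast+
qed

lemma partial_sum_le_zr:
  assumes c: "c > 1"
  shows "(\<Sum>n=1..N. real n powr (-c)) \<le> zr c"
proof -
  have s: "(\<lambda>n. real (Suc n) powr (-c)) sums zr c" by (rule zeta_real_sums[OF c])
  have "(\<Sum>n=1..N. real n powr (-c)) = (\<Sum>k<N. real (Suc k) powr (-c))"
    by (rule sum.reindex_bij_witness[of _ Suc "\<lambda>k. k - 1"]) auto
  also have "\<dots> \<le> zr c"
    unfolding sums_unique[OF s] by (rule sum_le_suminf) (use s in \<open>auto simp: summable_def\<close>)
  finally show ?thesis .
qed

section \<open>The off-diagonal sum\<close>

lemma harm_le_1_plus_ln: "N \<ge> 1 \<Longrightarrow> (harm N :: real) \<le> 1 + ln (real N)"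
  using euler_mascheroni_sequence_decreasing[of 1 N] by (simp add: harm_def)

text \<open>After exchanging the summations, the sum over \<open>r = m - n\<close> is harmonic of
  length \<open>N - n\<close>.\<close>

lemma sum_shifted_reciprocals_le:
  fixes g :: "nat \<Rightarrow> real"
  assumes g: "\<And>n. g n \<ge> 0"
  shows "(\<Sum>m=1..N. \<Sum>n=1..<m. g n / (real m - real n)) \<le> harm N * (\<Sum>n=1..N. g n)"
proof -
  have "(\<Sum>m=1..N. \<Sum>n=1..<m. g n / (real m - real n))
     = (\<Sum>m=1..N. \<Sum>n=1..N. if n < m then g n / (real m - real n) else 0)"
    by (intro sum.cong refl sum.mono_neutral_cong_left) auto
  also have "\<dots> = (\<Sum>n=1..N. \<Sum>m=1..N. if n < m then g n / (real m - real n) else 0)"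
    by (rule sum.swap)
  also have "\<dots> \<le> (\<Sum>n=1..N. harm N * g n)"
  proof (rule sum_mono)
    fix n assume n: "n \<in> {1..N}"
    have "(\<Sum>m=1..N. if n < m then g n / (real m - real n) else 0) = (\<Sum>r=1..N-n. g n / real r)"
      by (rule sum.reindex_bij_witness_not_neutral[of "{1..n}" "{}" _ "\<lambda>r. r + n" "\<lambda>m. m - n"]) (use n in \<open>auto simp: of_nat_diff\<close>)
    also have "\<dots> = g n * (\<Sum>r=1..N-n. 1 / real r)" by (simp add: sum_distrib_left)
    also have "\<dots> \<le> g n * (\<Sum>r=1..N. 1 / real r)"
      by (intro mult_left_mono g sum_mono2) auto
    finally show "(\<Sum>m=1..N. if n < m then g n / (real m - real n) else 0) \<le> harm N * g n"
      by (simp add: harm_def divide_inverse mult.commute)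
  qed
  finally show ?thesis by (simp add: sum_distrib_left)
qed

text \<open>The bracket of \<open>eps1\<close> with \<open>H0\<close> replaced by a variable, so
  that the estimate at \<open>T\<close> can be compared with the one at \<open>H0\<close>.\<close>

definition eps1_core :: "real \<Rightarrow> real \<Rightarrow> real" where
  "eps1_core \<sigma> T = ln T * T powr (1 - 2*\<sigma>) / (2 * (1 - \<sigma>))
     - (2*\<sigma> - 1) * ln T / (2 * (1 - \<sigma>) * T)
     + max 0 ((1 - 3*\<sigma> + 3*\<sigma>^2) / (2 * (1 - \<sigma>)^2) - zr (2*\<sigma>) / 2) / T
     + (2 - \<sigma>) * T powr (1 - 2*\<sigma>) / (2 * (1 - \<sigma>)^2)
     - \<sigma> * T powr (-\<sigma>) / (1 - \<sigma>)^2
     + T powr (-2*\<sigma>) / (2 * (2*\<sigma> - 1))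
     + T powr (-2*\<sigma> - 1) / 2"

lemma eps1_eq: "eps1 \<sigma> H = 4 * H0 / (H0 - H) * eps1_core \<sigma> H0"
  unfolding eps1_def eps1_core_def ..

text \<open>From \<open>ln x \<le> x - 1\<close> at \<open>x = n/m\<close> follows
  \<open>1 / ln (m/n) \<le> 1 + n / (m - n)\<close>. In the second part
  \<open>m powr (-\<sigma>)\<close> is enlarged to \<open>n powr (-\<sigma>)\<close>, so that the
  sum over \<open>m\<close> becomes harmonic.\<close>

lemma off_diagonal_term_le:
  fixes \<sigma> :: real
  assumes \<sigma>: "\<sigma> > 0" and nm: "1 \<le> n" "n < m"
  shows "real n powr (-\<sigma>) * real m powr (-\<sigma>) / (ln (real m) - ln (real n))
     \<le> real n powr (-\<sigma>) * real m powr (-\<sigma>) + real n powr (1 - 2*\<sigma>) / (real m - real n)"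
proof -
  have n: "real n > 0" "real m > real n" using nm by auto
  have "ln (real n / real m) \<le> real n / real m - 1" using n by (intro ln_le_minus_one) auto
  hence l: "ln (real m) - ln (real n) \<ge> (real m - real n) / real m"
    using n by (simp add: ln_div diff_divide_distrib)
  let ?c = "real n powr (-\<sigma>) * real m powr (-\<sigma>)"
  have "?c / (ln (real m) - ln (real n)) \<le> ?c / ((real m - real n) / real m)"
    using l n by (intro divide_left_mono) auto
  also have "\<dots> = ?c + ?c * real n / (real m - real n)" using n by (simp add: field_simps)
  also have "?c * real n \<le> (real n powr (-\<sigma>) * real n powr (-\<sigma>)) * real n powr 1"
    using n \<sigma> by (intro mult_mono powr_mono2') auto
  also have "\<dots> = real n powr (1 - 2*\<sigma>)" unfolding powr_add[symmetric] by (intro arg_cong2[of _ _ _ _ "(powr)"]) auto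
  finally show ?thesis using n by (simp add: divide_right_mono)
qed

text \<open>The first parts sum to half of \<open>A^2\<close> minus its diagonal \<open>Z\<close>,
  the second to at most \<open>harm N * G\<close>. As \<open>Z\<close> enters negatively, it is
  bounded below by \<open>zr (2*\<sigma>)\<close> minus a tail.\<close>

lemma off_diagonal_sum_le:
  fixes \<sigma> T :: real
  assumes \<sigma>: "1/2 < \<sigma>" "\<sigma> < 1" and T: "T \<ge> 1"
  shows "(\<Sum>m=1..nat \<lfloor>T\<rfloor>. \<Sum>n=1..<m. real n powr (-\<sigma>) * real m powr (-\<sigma>) / (ln (real m) - ln (real n)))
     \<le> T * eps1_core \<sigma> T"
proof -
  define N where "N = nat \<lfloor>T\<rfloor>"
  have N: "1 \<le> N" "real N \<le> T" unfolding N_def using T by (auto simp: le_nat_iff le_floor_iff)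
  define X where "X = T powr (1 - \<sigma>)"
  define A where "A = (\<Sum>n=1..N. real n powr (-\<sigma>))"
  define Z where "Z = (\<Sum>n=1..N. real n powr (-2*\<sigma>))"
  define G where "G = (\<Sum>n=1..N. real n powr (1 - 2*\<sigma>))"
  define b where "b = 1 - \<sigma>"
  have b: "b > 0" and \<sigma>b: "\<sigma> = 1 - b" using \<sigma> by (auto simp: b_def)
  have X2: "T powr (2 - 2*\<sigma>) = X^2" unfolding X_def power2_eq_square by (simp flip: powr_add)
  have A: "0 \<le> A" "A \<le> (X - \<sigma>) / (1 - \<sigma>)"
    unfolding A_def X_def using sum_powr_le[of \<sigma> N T] \<sigma> N by (auto intro: sum_nonneg)
  have G: "0 \<le> G" "G \<le> (X^2 - (2*\<sigma> - 1)) / (2 - 2*\<sigma>)"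
    unfolding G_def X2[symmetric] using sum_powr_le[of "2*\<sigma> - 1" N T] \<sigma> N by (auto intro: sum_nonneg)
  have Z: "Z \<ge> zr (2*\<sigma>) - T powr (-2*\<sigma>) - T powr (1 - 2*\<sigma>) / (2*\<sigma> - 1)"
    using zr_le_partial_sum[of "2*\<sigma>" T] \<sigma> T unfolding Z_def N_def by simp
  have h: "0 \<le> (harm N :: real)" "(harm N :: real) \<le> 1 + ln T"
  proof -
    have "(harm N :: real) \<le> 1 + ln (real N)" using N by (intro harm_le_1_plus_ln)
    also have "\<dots> \<le> 1 + ln T" using N by simp
    finally show "(harm N :: real) \<le> 1 + ln T" .
  qed (simp add: harm_nonneg)
  have AA: "A^2 = Z + 2 * (\<Sum>m=1..N. \<Sum>n=1..<m. real n powr (-\<sigma>) * real m powr (-\<sigma>))"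
  proof -
    have "A^2 = (\<Sum>n=1..N. \<Sum>m=1..N. real n powr (-\<sigma>) * real m powr (-\<sigma>))"
      unfolding A_def power2_eq_square sum_product ..
    also have "\<dots> = (\<Sum>n=1..N. real n powr (-\<sigma>) * real n powr (-\<sigma>))
       + 2 * (\<Sum>m=1..N. \<Sum>n=1..<m. real n powr (-\<sigma>) * real m powr (-\<sigma>))"
      by (rule sum_symmetric) (rule mult.commute)
    also have "(\<Sum>n=1..N. real n powr (-\<sigma>) * real n powr (-\<sigma>)) = Z"
      unfolding Z_def by (simp flip: powr_add)
    finally show ?thesis .
  qed
  have "(\<Sum>m=1..N. \<Sum>n=1..<m. real n powr (-\<sigma>) * real m powr (-\<sigma>) / (ln (real m) - ln (real n)))
     \<le> (\<Sum>m=1..N. \<Sum>n=1..<m. real n powr (-\<sigma>) * real m powr (-\<sigma>) + real n powr (1 - 2*\<sigma>) / (real m - real n))"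
    using \<sigma> by (intro sum_mono off_diagonal_term_le) auto
  also have "\<dots> = (A^2 - Z) / 2 + (\<Sum>m=1..N. \<Sum>n=1..<m. real n powr (1 - 2*\<sigma>) / (real m - real n))"
    unfolding sum.distrib AA by simp
  also have "(\<Sum>m=1..N. \<Sum>n=1..<m. real n powr (1 - 2*\<sigma>) / (real m - real n)) \<le> harm N * G"
    unfolding G_def by (rule sum_shifted_reciprocals_le) auto
  also have "harm N * G \<le> (1 + ln T) * ((X^2 - (2*\<sigma> - 1)) / (2 - 2*\<sigma>))"
    using h G T by (intro mult_mono) auto
  also have "A^2 \<le> ((X - \<sigma>) / (1 - \<sigma>))^2" using A by (intro power_mono) auto
  finally have P: "(\<Sum>m=1..N. \<Sum>n=1..<m. real n powr (-\<sigma>) * real m powr (-\<sigma>) / (ln (real m) - ln (real n)))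
     \<le> (((X - \<sigma>) / (1 - \<sigma>))^2 - Z) / 2 + (1 + ln T) * ((X^2 - (2*\<sigma> - 1)) / (2 - 2*\<sigma>))" by simp
  let ?M = "(1 - 3*\<sigma> + 3*\<sigma>^2) / (2 * (1 - \<sigma>)^2) - zr (2*\<sigma>) / 2"
  \<comment> \<open>Sorted by powers of \<open>X\<close> and \<open>ln T\<close>. The constant term
    joins \<open>\<sigma>^2 / (2 * (1 - \<sigma>)^2)\<close> and
    \<open>- (2*\<sigma> - 1) / (2 * (1 - \<sigma>))\<close>.\<close>
  have e: "((X - \<sigma>) / (1 - \<sigma>))^2 / 2 + (1 + ln T) * ((X^2 - (2*\<sigma> - 1)) / (2 - 2*\<sigma>))
    = ln T * X^2 / (2 * (1 - \<sigma>)) - (2*\<sigma> - 1) * ln T / (2 * (1 - \<sigma>))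
     + (1 - 3*\<sigma> + 3*\<sigma>^2) / (2 * (1 - \<sigma>)^2) + (2 - \<sigma>) * X^2 / (2 * (1 - \<sigma>)^2) - \<sigma> * X / (1 - \<sigma>)^2"
    using b unfolding \<sigma>b by (simp add: divide_simps power2_eq_square) (simp add: algebra_simps)
  have Tp: "T * T powr y = T powr (1 + y)" for y using T by (simp add: powr_add)
  have T1: "T * T powr (1 - 2*\<sigma>) = X^2" "T * T powr (-\<sigma>) = X" "T * T powr (-2*\<sigma>) = T powr (1 - 2*\<sigma>)"
    "T * T powr (-2*\<sigma> - 1) = T powr (-2*\<sigma>)"
    unfolding Tp using X2 by (simp_all add: X_def)
  have "T * eps1_core \<sigma> T = ln T * X^2 / (2 * (1 - \<sigma>)) - (2*\<sigma> - 1) * ln T / (2 * (1 - \<sigma>))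
     + max 0 ?M + (2 - \<sigma>) * X^2 / (2 * (1 - \<sigma>)^2) - \<sigma> * X / (1 - \<sigma>)^2
     + T powr (1 - 2*\<sigma>) / (2 * (2*\<sigma> - 1)) + T powr (-2*\<sigma>) / 2"
  proof -
    have "T * eps1_core \<sigma> T = ln T * (T * T powr (1 - 2*\<sigma>)) / (2 * (1 - \<sigma>)) - (2*\<sigma> - 1) * ln T / (2 * (1 - \<sigma>)) * (T / T)
     + max 0 ?M * (T / T) + (2 - \<sigma>) * (T * T powr (1 - 2*\<sigma>)) / (2 * (1 - \<sigma>)^2) - \<sigma> * (T * T powr (-\<sigma>)) / (1 - \<sigma>)^2
     + (T * T powr (-2*\<sigma>)) / (2 * (2*\<sigma> - 1)) + (T * T powr (-2*\<sigma> - 1)) / 2"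
      unfolding eps1_core_def distrib_left right_diff_distrib by (simp only: mult_ac times_divide_eq_right times_divide_eq_left divide_divide_eq_left)
    thus ?thesis unfolding T1 using T by simp
  qed
  note core = this
  define V where "V = ln T * X^2 / (2 * (1 - \<sigma>)) - (2*\<sigma> - 1) * ln T / (2 * (1 - \<sigma>))
     + (2 - \<sigma>) * X^2 / (2 * (1 - \<sigma>)^2) - \<sigma> * X / (1 - \<sigma>)^2"
  define m where "m = (1 - 3*\<sigma> + 3*\<sigma>^2) / (2 * (1 - \<sigma>)^2)"
  define p1 where "p1 = T powr (1 - 2*\<sigma>) / (2*\<sigma> - 1)"
  define p2 where "p2 = T powr (-2*\<sigma>)"
  define z where "z = zr (2*\<sigma>)"
  define q1 where "q1 = ((X - \<sigma>) / (1 - \<sigma>))^2"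
  define q2 where "q2 = (1 + ln T) * ((X^2 - (2*\<sigma> - 1)) / (2 - 2*\<sigma>))"
  have eV: "q1 / 2 + q2 = V + m"
    unfolding q1_def q2_def e V_def m_def by simp
  have "z - p2 - p1 \<le> Z" using Z unfolding z_def p1_def p2_def .
  hence "(q1 - Z) / 2 + q2 \<le> V + (m - z / 2) + p1 / 2 + p2 / 2" using eV by argo
  \<comment> \<open>With the positive part, this contribution divided by \<open>T\<close> is
    nonincreasing whatever the sign of \<open>m - z / 2\<close>.\<close>
  also have "\<dots> \<le> V + max 0 (m - z / 2) + p1 / 2 + p2 / 2" by simp
  also have "\<dots> = T * eps1_core \<sigma> T"
    unfolding core V_def m_def p1_def p2_def z_def by simp
  finally show ?thesis using P unfolding N_def[symmetric] q1_def[symmetric] q2_def[symmetric] by (rule order_trans[rotated])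
qed

text \<open>The expression is \<open>- exp u\<close> times the derivative of \<open>g\<close> in
  \<open>eps1_core_antimono\<close>, where \<open>b = 1 - \<sigma>\<close> and
  \<open>u = ln T\<close>. The range of \<open>b\<close> is that of \<sigma>, and 24 is a lower
  bound for \<open>ln H0\<close>.\<close>

lemma monotonicity_polynomial:
  fixes b u :: real
  assumes b: "277/10000 \<le> b" "b \<le> 4792/10000" and u: "u \<ge> 24"
  defines "x \<equiv> exp (b * u)"
  shows "x^2 * ((1 - 2*b) * (b*u + 1) - 2*b^2) - 2 * (1-b)^2 * x - b * (u - 1) * (1 - 2*b) \<ge> 0"
proof -
  define v where "v = b * u"
  define B where "B = (1 - 2*b) * (v + 1) - 2*b^2"
  \<comment> \<open>The quadratic Taylor polynomial of \<open>exp (24 * b)\<close>, a lower bound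
    for \<open>x\<close>.\<close>
  define y where "y = 1 + 24*b + 288*b^2"
  have v: "v \<ge> 24 * b" using mult_left_mono[of 24 u b] b u by (simp add: v_def mult.commute)
  have x: "x \<ge> 1 + v + v^2/2" unfolding x_def v_def[symmetric]
    using v b by (intro exp_lower_Taylor_quadratic) auto
  have "v^2 \<ge> (24*b)^2" using v b by (intro power_mono) auto
  hence xy: "x \<ge> y" using x v by (simp add: y_def power_mult_distrib)
  have B0: "B \<ge> 1 + 22*b - 50*b^2"
  proof -
    have "(1 - 2*b) * (v + 1) \<ge> (1 - 2*b) * (24*b + 1)" using v b by (intro mult_left_mono) auto
    thus ?thesis unfolding B_def by (simp add: algebra_simps power2_eq_square)
  qed
  have Bpos: "1 + 22*b - 50*b^2 \<ge> 0"
  proof -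
    have "50 * b^2 \<le> 50 * (4792/10000 * b)" using b unfolding power2_eq_square by (intro mult_left_mono mult_right_mono) auto
    thus ?thesis using b by simp
  qed
  have y0: "y \<ge> 0" using b by (simp add: y_def)
  \<comment> \<open>This is \<open>(1 + 22*b - 50*b^2) * y \<ge> 2 * (1-b)^2 + (1 - 2*b)\<close>
    expanded. For small \<open>b\<close> the part with \<open>b^2\<close> makes up for
    \<open>-2 + 52*b\<close>, in the middle both are nonnegative, and for large \<open>b\<close> the
    roles are reversed.\<close>
  have poly: "-2 + 52*b + b^2 * (764 + 5136*b - 14400*b^2) \<ge> 0"
  proof -
    have lo: "b^2 \<ge> (277/10000)^2" using b by (intro power_mono) auto
    have sq: "b^2 \<le> c * b" if "b \<le> c" for c using that b unfolding power2_eq_square by (intro mult_right_mono) auto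
    consider "b \<le> 1/10" | "1/10 < b" "b \<le> 45/100" | "45/100 < b" by linarith
    thus ?thesis
    proof cases
      case 1
      have "(277/10000)^2 * 866 \<le> b^2 * (764 + 5136*b - 14400*b^2)"
        using sq[OF 1] b lo by (intro mult_mono) auto
      thus ?thesis using b by (simp add: power2_eq_square)
    next
      case 2
      have "0 \<le> b^2 * (764 + 5136*b - 14400*b^2)"
        using sq[OF 2(2)] 2 by (intro mult_nonneg_nonneg) auto
      thus ?thesis using 2 by simp
    next
      case 3
      have "b^2 * (-82) \<le> b^2 * (764 + 5136*b - 14400*b^2)"
        using sq[OF b(2)] b by (intro mult_left_mono) auto
      moreover have "b^2 \<le> (4792/10000)^2" using b by (intro power_mono) auto
      ultimately show ?thesis using 3 by (simp add: power2_eq_square)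
    qed
  qed
  have "(1 + 22*b - 50*b^2) * y = 1 + 46*b + 766*b^2 + 5136*b^3 - 14400*b^4"
    unfolding y_def by (simp add: algebra_simps numeral_eq_Suc)
  moreover have "b^2 * (764 + 5136*b - 14400*b^2) = 764*b^2 + 5136*b^3 - 14400*b^4"
    by (simp add: algebra_simps numeral_eq_Suc)
  ultimately have "(1 + 22*b - 50*b^2) * y \<ge> 2 * (1-b)^2 + (1 - 2*b)"
    using poly by (simp add: power2_diff)
  also have "(1 + 22*b - 50*b^2) * y \<le> B * x"
    using B0 Bpos xy y0 by (intro mult_mono) auto
  finally have "B * x - 2 * (1-b)^2 \<ge> 1 - 2*b" by simp
  \<comment> \<open>The surplus \<open>1 - 2*b\<close> times \<open>x\<close> absorbs the last term,
    because \<open>x \<ge> b * (u - 1)\<close>.\<close>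
  hence "x * (B * x - 2 * (1-b)^2) \<ge> x * (1 - 2*b)" by (intro mult_left_mono) (auto simp: x_def)
  also have "x * (1 - 2*b) \<ge> (b * (u - 1)) * (1 - 2*b)"
  proof (intro mult_right_mono)
    have "b * (u - 1) \<le> v" using b by (simp add: v_def algebra_simps)
    moreover have "v \<le> x" using x zero_le_power2[of v] by linarith
    ultimately show "b * (u - 1) \<le> x" by simp
  qed (use b in auto)
  finally show ?thesis unfolding B_def v_def by (simp add: algebra_simps power2_eq_square)
qed

text \<open>\<open>2.72 ^ 24\<close> is about \<open>2.69 * 10^10\<close>, still below
  \<open>H0\<close>.\<close>

lemma ln_H0_ge: "ln H0 \<ge> 24"
proof -
  have "exp (24::real) = exp 1 ^ 24" by (simp flip: exp_of_nat_mult)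
  also have "\<dots> \<le> (272/100) ^ 24" using e_less_272 by (intro power_mono) auto
  also have "\<dots> \<le> H0" unfolding H0_def by (simp add: power_divide)
  finally show ?thesis by (subst ln_ge_iff) (auto simp: H0_def)
qed

text \<open>In the variable \<open>u = ln T\<close> the terms of mixed sign combine to
  \<open>g u / (2 * b^2)\<close>, whose derivative \<open>monotonicity_polynomial\<close> controls;
  each other term is a nonnegative multiple of a negative power of \<open>T\<close>.\<close>

lemma eps1_core_antimono:
  fixes \<sigma> T :: real
  assumes \<sigma>: "0.5208 < \<sigma>" "\<sigma> < 0.9723" and T: "H0 \<le> T"
  shows "eps1_core \<sigma> T \<le> eps1_core \<sigma> H0"
proof -
  define b where "b = 1 - \<sigma>"
  have b: "277/10000 \<le> b" "b \<le> 4792/10000" and \<sigma>b: "\<sigma> = 1 - b" using \<sigma> by (auto simp: b_def)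
  have H0: "H0 > 0" by (simp add: H0_def)
  define g where "g = (\<lambda>u. exp (-u) * (b * u * exp (2*b*u) - b * (1 - 2*b) * u + (1 + b) * exp (2*b*u) - 2 * (1 - b) * exp (b*u)))"
  have core: "eps1_core \<sigma> x = g (ln x) / (2 * b^2)
     + max 0 ((1 - 3*\<sigma> + 3*\<sigma>^2) / (2 * (1 - \<sigma>)^2) - zr (2*\<sigma>) / 2) / x
     + x powr (-2*\<sigma>) / (2 * (2*\<sigma> - 1)) + x powr (-2*\<sigma> - 1) / 2" if x: "x > 0" for x
  proof -
    have p: "x powr (1 - 2*\<sigma>) = exp (- ln x) * exp (2*b* ln x)" "x powr (-\<sigma>) = exp (- ln x) * exp (b * ln x)"
      using x by (simp_all add: powr_def \<sigma>b algebra_simps flip: exp_add)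
    have e: "exp (- ln x) = 1 / x" using x by (simp add: exp_minus divide_inverse)
    show ?thesis unfolding eps1_core_def p g_def e using b x unfolding \<sigma>b
      by (simp add: field_simps power2_eq_square)
  qed
  have "g (ln T) \<le> g (ln H0)"
  proof (rule DERIV_nonpos_imp_nonincreasing[of "ln H0" "ln T" g])
    show "ln H0 \<le> ln T" using T H0 by simp
    fix u assume u: "ln H0 \<le> u" "u \<le> ln T"
    let ?x = "exp (b * u)"
    have x2: "exp (2*b*u) = ?x^2" by (simp add: power2_eq_square flip: exp_add)
    let ?D = "- exp (-u) * (?x^2 * ((1 - 2*b) * (b*u + 1) - 2*b^2) - 2 * (1-b)^2 * ?x - b * (u - 1) * (1 - 2*b))"
    have "(g has_real_derivative ?D) (at u)"
      unfolding g_def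
      by (rule derivative_eq_intros refl)+ (simp only: x2, simp add: algebra_simps power2_eq_square)
    moreover have "?D \<le> 0"
      using monotonicity_polynomial[of b u] b u ln_H0_ge by (simp add: mult_nonneg_nonneg)
    ultimately show "\<exists>y. (g has_real_derivative y) (at u) \<and> y \<le> 0" by blast
  qed
  thus ?thesis using T H0 b \<sigma> unfolding core[OF H0] core[OF less_le_trans[OF H0 T]]
    by (intro add_mono divide_right_mono divide_left_mono powr_mono2') auto
qed

section \<open>Mean values of the zeta function\<close>

lemma powr_difference_quotient_bounds:
  fixes c x y :: real
  assumes "0 < x" "x \<le> y" "c > 1"
  shows "(y - x) * y powr (-c) \<le> (x powr (1 - c) - y powr (1 - c)) / (c - 1)"
    and "(x powr (1 - c) - y powr (1 - c)) / (c - 1) \<le> (y - x) * x powr (-c)"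
proof -
  have flip: "(y powr (1 - c) - x powr (1 - c)) / (1 - c) = (x powr (1 - c) - y powr (1 - c)) / (c - 1)"
    by (metis minus_diff_eq minus_divide_divide)
  have "\<exists>z\<ge>x. z \<le> y \<and> (x powr (1 - c) - y powr (1 - c)) / (c - 1) = (y - x) * z powr (-c)"
  proof (cases "x = y")
    case False
    have "\<exists>z>x. z < y \<and> y powr (1 - c) / (1 - c) - x powr (1 - c) / (1 - c) = (y - x) * z powr (-c)"
      using assms False by (intro MVT2) (auto intro!: derivative_eq_intros)
    thus ?thesis unfolding diff_divide_distrib[symmetric] flip by (auto intro: less_imp_le)
  qed auto
  then obtain z where z: "z \<ge> x" "z \<le> y" "(x powr (1 - c) - y powr (1 - c)) / (c - 1) = (y - x) * z powr (-c)" by blast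
  show "(y - x) * y powr (-c) \<le> (x powr (1 - c) - y powr (1 - c)) / (c - 1)"
    unfolding z(3) using z assms by (intro mult_left_mono powr_mono2') auto
  show "(x powr (1 - c) - y powr (1 - c)) / (c - 1) \<le> (y - x) * x powr (-c)"
    unfolding z(3) using z assms by (intro mult_left_mono powr_mono2') auto
qed

lemma has_integral_powr_neg:
  fixes c H T :: real
  assumes "0 < H" "H \<le> T" "c > 1"
  shows "((\<lambda>t. t powr (-c)) has_integral (H powr (1 - c) - T powr (1 - c)) / (c - 1)) {H..T}"
proof -
  have "((\<lambda>t. t powr (-c)) has_integral (T powr (1 - c) / (1 - c) - H powr (1 - c) / (1 - c))) {H..T}"
    using assms by (intro fundamental_theorem_of_calculus)
      (auto intro!: derivative_eq_intros simp flip: has_real_derivative_iff_has_vector_derivative)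
  also have "T powr (1 - c) / (1 - c) - H powr (1 - c) / (1 - c) = (H powr (1 - c) - T powr (1 - c)) / (c - 1)"
    unfolding diff_divide_distrib[symmetric] by (metis minus_diff_eq minus_divide_divide)
  finally show ?thesis .
qed

text \<open>The mean of a decreasing function over \<open>{H..T}\<close> is at most that over
  \<open>{H..H0}\<close>: the value at \<open>H0\<close> lies above the mean over the added stretch
  and below the mean over \<open>{H..H0}\<close>.\<close>

lemma integral_remainder_le_eps2:
  fixes \<sigma> H T :: real
  assumes \<sigma>: "\<sigma> > 1/2" and H: "0 < H" "H < H0" "H0 \<le> T"
  shows "c0^2 * integral {H..T} (\<lambda>t. t powr (-2*\<sigma>)) \<le> (T - H) * eps2 \<sigma> H"
proof -
  define I where "I = (\<lambda>x y :: real. (x powr (1 - 2*\<sigma>) - y powr (1 - 2*\<sigma>)) / (2*\<sigma> - 1))"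
  have int: "integral {H..T} (\<lambda>t. t powr (-2*\<sigma>)) = I H T"
    using has_integral_powr_neg[of H T "2*\<sigma>"] \<sigma> H by (intro integral_unique) (simp add: I_def)
  have 1: "I H0 T \<le> (T - H0) * H0 powr (-2*\<sigma>)"
    using powr_difference_quotient_bounds(2)[of H0 T "2*\<sigma>"] \<sigma> H by (simp add: I_def)
  have 2: "(H0 - H) * H0 powr (-2*\<sigma>) \<le> I H H0"
    using powr_difference_quotient_bounds(1)[of H H0 "2*\<sigma>"] \<sigma> H by (simp add: I_def)
  have "(H0 - H) * I H T = (H0 - H) * I H H0 + (H0 - H) * I H0 T"
    by (simp add: I_def diff_divide_distrib algebra_simps)
  also have "(H0 - H) * I H0 T \<le> (H0 - H) * ((T - H0) * H0 powr (-2*\<sigma>))"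
    using 1 H by (intro mult_left_mono) auto
  also have "\<dots> = (T - H0) * ((H0 - H) * H0 powr (-2*\<sigma>))" by simp
  also have "\<dots> \<le> (T - H0) * I H H0" using 2 H by (intro mult_left_mono) auto
  finally have "(H0 - H) * I H T \<le> (T - H) * I H H0" by (simp add: algebra_simps)
  hence "I H T \<le> (T - H) * (I H H0 / (H0 - H))" using H by (simp add: field_simps)
  hence "c0^2 * I H T \<le> c0^2 * ((T - H) * (I H H0 / (H0 - H)))" by (intro mult_left_mono) auto
  also have "\<dots> = (T - H) * eps2 \<sigma> H"
    by (simp add: eps2_def I_def)
  finally show ?thesis unfolding int .
qed

text \<open>For \<open>T \<ge> H0\<close> both \<open>T / (T - H)\<close> and
  \<open>eps1_core \<sigma> T\<close> are largest at \<open>T = H0\<close>.\<close>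

lemma dirichlet_polynomial_mean_square_le:
  fixes \<sigma> H T :: real
  assumes \<sigma>: "0.5208 < \<sigma>" "\<sigma> < 0.9723" and H: "0 < H" "H < H0" and T: "H0 \<le> T"
  shows "integral {H..T} (\<lambda>t. norm (\<Sum>n=1..nat \<lfloor>t\<rfloor>. 1 / (of_nat n :: complex) powr Complex \<sigma> t) ^ 2)
      \<le> (T - H) * (zr (2*\<sigma>) + eps1 \<sigma> H)"
    and "eps1 \<sigma> H \<ge> 0"
proof -
  have H01: "H0 \<ge> 1" by (simp add: H0_def)
  define P where "P = (\<lambda>T::real. \<Sum>m=1..nat \<lfloor>T\<rfloor>. \<Sum>n=1..<m. real n powr (-\<sigma>) * real m powr (-\<sigma>) / (ln (real m) - ln (real n)))"
  have P0: "P T \<ge> 0" for T unfolding P_def by (intro sum_nonneg divide_nonneg_nonneg) auto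
  have Pc: "P T \<le> T * eps1_core \<sigma> T" if "T \<ge> 1" for T :: real
    unfolding P_def using off_diagonal_sum_le[of \<sigma> T] \<sigma> that by simp
  \<comment> \<open>The signs in \<open>eps1_core\<close> do not show this; it follows because
    \<open>T * eps1_core \<sigma> T\<close> bounds a nonnegative sum.\<close>
  have core0: "eps1_core \<sigma> T \<ge> 0" if "T \<ge> 1" for T :: real
    using order_trans[OF P0 Pc[OF that]] that by (simp add: zero_le_mult_iff)
  show "eps1 \<sigma> H \<ge> 0" unfolding eps1_eq using H core0[OF H01] H01 by simp
  have "T * eps1_core \<sigma> T \<le> T * eps1_core \<sigma> H0"
    using eps1_core_antimono[OF \<sigma> T] T H01 by (intro mult_left_mono) auto
  also have "\<dots> \<le> ((T - H) * (H0 / (H0 - H))) * eps1_core \<sigma> H0"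
  proof (rule mult_right_mono)
    have "T * (H0 - H) \<le> (T - H) * H0" using T H by (simp add: algebra_simps mult_left_mono)
    thus "T \<le> (T - H) * (H0 / (H0 - H))" using H by (simp add: field_simps)
  qed (rule core0[OF H01])
  finally have "P T \<le> ((T - H) * (H0 / (H0 - H))) * eps1_core \<sigma> H0"
    using Pc[of T] T H01 by linarith
  hence "4 * P T \<le> 4 * (((T - H) * (H0 / (H0 - H))) * eps1_core \<sigma> H0)" by simp
  also have "\<dots> = (T - H) * eps1 \<sigma> H" unfolding eps1_eq by simp
  finally have "4 * P T \<le> (T - H) * eps1 \<sigma> H" .
  moreover have "(T - H) * (\<Sum>n=1..nat \<lfloor>T\<rfloor>. real n powr (-2*\<sigma>)) \<le> (T - H) * zr (2*\<sigma>)"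
    using partial_sum_le_zr[of "2*\<sigma>" "nat \<lfloor>T\<rfloor>"] \<sigma> H T by (intro mult_left_mono) auto
  moreover have "integral {H..T} (\<lambda>t. norm (\<Sum>n=1..nat \<lfloor>t\<rfloor>. 1 / (of_nat n :: complex) powr Complex \<sigma> t) ^ 2)
     \<le> (T - H) * (\<Sum>n=1..nat \<lfloor>T\<rfloor>. real n powr (-2*\<sigma>)) + 4 * P T"
    unfolding P_def using H T by (intro dirichlet_polynomial_mean_square) auto
  ultimately show "integral {H..T} (\<lambda>t. norm (\<Sum>n=1..nat \<lfloor>t\<rfloor>. 1 / (of_nat n :: complex) powr Complex \<sigma> t) ^ 2)
      \<le> (T - H) * (zr (2*\<sigma>) + eps1 \<sigma> H)" by (simp add: distrib_left)
qed

lemma power2_add_le_weighted: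
  fixes x y l :: real
  assumes "l > 0"
  shows "(x + y)^2 \<le> (1 + l) * x^2 + (1 + 1/l) * y^2"
proof -
  have "0 \<le> (l * x - y)^2 / l" using assms by simp
  also have "\<dots> = l * x^2 - 2 * x * y + y^2 / l"
    using assms by (simp add: field_simps power2_eq_square)
  finally show ?thesis by (simp add: power2_eq_square algebra_simps)
qed

lemma continuous_on_zeta_vertical:
  assumes "\<sigma> > 0" "0 < a"
  shows "continuous_on {a..b} (\<lambda>t. zeta (Complex \<sigma> t))"
proof -
  have "continuous_on {a..b} (\<lambda>t. Complex \<sigma> t)"
    unfolding Complex_eq by (intro continuous_intros)
  moreover have "(\<lambda>t. Complex \<sigma> t) ` {a..b} \<subseteq> {s. Re s > 0} - {1}"
    using assms by (auto simp: complex_eq_iff)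
  ultimately show ?thesis
    using continuous_on_compose2[OF holomorphic_on_imp_continuous_on[OF holomorphic_zeta]] by blast
qed

lemma negligible_zeta_zeros_vertical:
  assumes "\<sigma> > 0" "0 < a"
  shows "negligible {t \<in> {a..b}. zeta (Complex \<sigma> t) = 0}"
proof -
  have "{t \<in> {a..b}. zeta (Complex \<sigma> t) = 0} \<subseteq> Im ` {s. Re s > 0 \<and> s \<noteq> 1 \<and> zeta s = 0}"
  proof
    fix t assume "t \<in> {t \<in> {a..b}. zeta (Complex \<sigma> t) = 0}"
    hence "Complex \<sigma> t \<in> {s. Re s > 0 \<and> s \<noteq> 1 \<and> zeta s = 0}"
      using assms by (auto simp: complex_eq_iff)
    thus "t \<in> Im ` {s. Re s > 0 \<and> s \<noteq> 1 \<and> zeta s = 0}" by (metis complex.sel(2) imageI)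
  qed
  hence "countable {t \<in> {a..b}. zeta (Complex \<sigma> t) = 0}"
    by (rule countable_subset[OF _ countable_image[OF countable_zeta_zeros]])
  thus ?thesis
    unfolding negligible_iff_null_sets by (intro null_sets_completionI countable_imp_null_set_lborel)
qed

theorem theorem3:
  fixes \<sigma>0 H T :: real
  assumes "0.5208 < \<sigma>0" and "\<sigma>0 < 0.9723"
    and "10^3 \<le> H" and "H < H0" and "H0 \<le> T"
  shows "((1 / (T - H)) * integral {H..T} (\<lambda>t. (cmod (zeta (Complex \<sigma>0 t)))^2)
           \<le> zr (2*\<sigma>0) + E1 \<sigma>0 H)
       \<and> (integral {H..T} (\<lambda>t. ln (cmod (zeta (Complex \<sigma>0 t))))
           \<le> (T - H) / 2 * ln (zr (2*\<sigma>0) + E1 \<sigma>0 H))"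
proof -
  have H: "0 < H" "H < T" using assms by auto
  have \<sigma>: "1/2 < \<sigma>0" "\<sigma>0 < 1" using assms by auto
  define S where "S = (\<lambda>t. \<Sum>n=1..nat \<lfloor>t\<rfloor>. 1 / (of_nat n :: complex) powr Complex \<sigma>0 t)"
  define A where "A = zr (2*\<sigma>0) + eps1 \<sigma>0 H"
  define B where "B = eps2 \<sigma>0 H"
  \<comment> \<open>This weight minimises \<open>l * A + B / l\<close>; the minimum
    \<open>2 * sqrt (B * A)\<close> is \<open>eps3\<close>.\<close>
  define l where "l = sqrt (B / A)"
  define E where "E = zr (2*\<sigma>0) + E1 \<sigma>0 H"
  have A1: "A \<ge> 1"
    using zr_ge_1[of "2*\<sigma>0"] dirichlet_polynomial_mean_square_le(2)[OF assms(1,2) H(1) assms(4,5)] \<sigma>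
    by (simp add: A_def)
  have B0: "B > 0"
  proof -
    have "H0 powr (-(2*\<sigma>0 - 1)) < H powr (-(2*\<sigma>0 - 1))"
      using assms H \<sigma> by (intro powr_less_mono2_neg) auto
    thus ?thesis unfolding B_def eps2_def using \<sigma> assms(4)
      by (intro divide_pos_pos mult_pos_pos) (auto simp: c0_def)
  qed
  have l0: "l > 0" using A1 B0 by (simp add: l_def)
  have E: "E = (1 + l) * A + (1 + 1/l) * B"
  proof -
    have "l * A = sqrt (B * A)"
      using A1 B0 by (simp add: l_def real_sqrt_divide real_sqrt_mult field_simps)
    moreover have "B / l = sqrt (B * A)"
      using A1 B0 by (simp add: l_def real_sqrt_divide real_sqrt_mult real_div_sqrt field_simps)
    moreover have "E = A + B + 2 * sqrt (B * A)" by (simp add: E_def E1_def eps3_def A_def B_def)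
    moreover have "(1 + l) * A + (1 + 1/l) * B = A + l * A + B + B / l" by (simp add: algebra_simps)
    ultimately show ?thesis by simp
  qed
  have E1: "E \<ge> 1"
  proof -
    have "E \<ge> A" using l0 A1 B0 by (simp add: E algebra_simps)
    thus ?thesis using A1 by simp
  qed
  have Sint: "(\<lambda>t. norm (S t) ^ 2) integrable_on {H..T}"
    unfolding S_def using H by (intro dirichlet_polynomial_mean_square) auto
  have Sle: "integral {H..T} (\<lambda>t. norm (S t) ^ 2) \<le> (T - H) * A"
    unfolding S_def A_def by (rule dirichlet_polynomial_mean_square_le[OF assms(1,2) H(1) assms(4,5)])
  have pint: "(\<lambda>t. t powr (-2*\<sigma>0)) integrable_on {H..T}"
    using has_integral_powr_neg[of H T "2*\<sigma>0"] H \<sigma> by auto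
  have zint: "(\<lambda>t. norm (zeta (Complex \<sigma>0 t)) ^ 2) integrable_on {H..T}"
    using \<sigma> H by (intro integrable_continuous_real continuous_intros continuous_on_zeta_vertical) auto
  have pw: "norm (zeta (Complex \<sigma>0 t)) ^ 2 \<le> (1 + l) * norm (S t) ^ 2 + (1 + 1/l) * (c0^2 * t powr (-2*\<sigma>0))"
    if t: "t \<in> {H..T}" for t
  proof -
    have R: "norm (zeta (Complex \<sigma>0 t) - S t) \<le> c0 * t powr (-\<sigma>0)"
      unfolding S_def using \<sigma> t assms by (intro zeta_approximation) auto
    have "norm (zeta (Complex \<sigma>0 t)) \<le> norm (S t) + c0 * t powr (-\<sigma>0)"
      using norm_triangle_sub[of "zeta (Complex \<sigma>0 t)" "S t"] R by simp
    hence "norm (zeta (Complex \<sigma>0 t)) ^ 2 \<le> (norm (S t) + c0 * t powr (-\<sigma>0)) ^ 2"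
      by (intro power_mono) auto
    also have "\<dots> \<le> (1 + l) * norm (S t) ^ 2 + (1 + 1/l) * (c0 * t powr (-\<sigma>0)) ^ 2"
      by (rule power2_add_le_weighted[OF l0])
    also have "(c0 * t powr (-\<sigma>0)) ^ 2 = c0^2 * t powr (-2*\<sigma>0)"
      by (simp add: power_mult_distrib power2_eq_square[of "t powr _"] flip: powr_add)
    finally show ?thesis .
  qed
  have "integral {H..T} (\<lambda>t. norm (zeta (Complex \<sigma>0 t)) ^ 2)
     \<le> integral {H..T} (\<lambda>t. (1 + l) * norm (S t) ^ 2 + (1 + 1/l) * (c0^2 * t powr (-2*\<sigma>0)))"
    using zint Sint pint pw by (intro integral_le integrable_add integrable_on_mult_right) auto
  also have "\<dots> = (1 + l) * integral {H..T} (\<lambda>t. norm (S t) ^ 2)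
      + (1 + 1/l) * (c0^2 * integral {H..T} (\<lambda>t. t powr (-2*\<sigma>0)))"
    using Sint pint by (subst integral_add) (auto intro!: integrable_on_mult_right)
  also have "\<dots> \<le> (1 + l) * ((T - H) * A) + (1 + 1/l) * ((T - H) * B)"
    unfolding B_def using l0 Sle integral_remainder_le_eps2[of \<sigma>0 H T] \<sigma> H assms
    by (intro add_mono mult_left_mono) auto
  also have "\<dots> = (T - H) * E" unfolding E by (simp only: distrib_left mult.left_commute)
  finally have J: "integral {H..T} (\<lambda>t. norm (zeta (Complex \<sigma>0 t)) ^ 2) \<le> (T - H) * E" .
  have "integral {H..T} (\<lambda>t. ln (cmod (zeta (Complex \<sigma>0 t)))) \<le> (T - H) / 2 * ln E"
  proof (cases "(\<lambda>t. ln (cmod (zeta (Complex \<sigma>0 t)))) integrable_on {H..T}")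
    case False
    \<comment> \<open>A non-integrable function has integral 0 by convention, and
      \<open>E \<ge> 1\<close> makes the right side nonnegative.\<close>
    thus ?thesis using E1 H by (simp add: not_integrable_integral)
  next
    case True
    define Z where "Z = {t \<in> {H..T}. zeta (Complex \<sigma>0 t) = 0}"
    have Z: "negligible Z" unfolding Z_def using \<sigma> H by (intro negligible_zeta_zeros_vertical) auto
    let ?f = "\<lambda>t. ln (cmod (zeta (Complex \<sigma>0 t)))"
    \<comment> \<open>The tangent at \<open>w^2 = E\<close> to \<open>ln w = ln (w^2) / 2\<close>,
      seen as a concave function of \<open>w^2\<close>; integrating it proves the instance of
      Jensen's inequality.\<close>
    let ?g = "\<lambda>t. cmod (zeta (Complex \<sigma>0 t)) ^ 2 * (1 / (2 * E)) + (ln E - 1) / 2"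
    \<comment> \<open>On the zero set, \<open>ln 0 = 0\<close> need not lie below the tangent line, so the values there are replaced.\<close>
    let ?f' = "\<lambda>t. if t \<in> Z then ?g t else ?f t"
    have le: "?f' t \<le> ?g t" if "t \<in> {H..T}" for t
    proof (cases "t \<in> Z")
      case False
      define w where "w = cmod (zeta (Complex \<sigma>0 t))"
      have w: "w > 0" using False that by (auto simp: Z_def w_def)
      have "ln (w^2 / E) \<le> w^2 / E - 1" using w E1 by (intro ln_le_minus_one) auto
      moreover have "ln (w^2 / E) = 2 * ln w - ln E" using w E1 by (simp add: ln_div ln_realpow)
      ultimately have "ln w \<le> w^2 * (1 / (2 * E)) + (ln E - 1) / 2" by (simp add: field_simps)
      thus ?thesis using False by (simp add: w_def)
    qed simp
    have f': "?f' integrable_on {H..T}" by (rule integrable_spike[OF True Z]) auto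
    have g: "(?g has_integral (integral {H..T} (\<lambda>t. norm (zeta (Complex \<sigma>0 t)) ^ 2) * (1 / (2 * E)) + (T - H) * ((ln E - 1) / 2))) {H..T}"
      using has_integral_add[OF has_integral_mult_left[OF integrable_integral[OF zint], of "1 / (2 * E)"]
          has_integral_const_real[of "(ln E - 1) / 2" H T]] H by simp
    have "integral {H..T} ?f = integral {H..T} ?f'" by (rule integral_spike[OF Z]) auto
    also have "\<dots> \<le> integral {H..T} ?g" using f' g le by (intro integral_le) auto
    also have "\<dots> = integral {H..T} (\<lambda>t. norm (zeta (Complex \<sigma>0 t)) ^ 2) * (1 / (2 * E)) + (T - H) * ((ln E - 1) / 2)"
      using g by (rule integral_unique)
    also have "\<dots> \<le> ((T - H) * E) * (1 / (2 * E)) + (T - H) * ((ln E - 1) / 2)"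
      using J E1 by (intro add_right_mono mult_right_mono) auto
    \<comment> \<open>The mean square contributes \<open>(T - H) / 2\<close>, which cancels the
      \<open>- 1\<close> of the tangent.\<close>
    also have "\<dots> = (T - H) / 2 * ln E" using E1 by (simp add: field_simps)
    finally show ?thesis .
  qed
  moreover have "(1 / (T - H)) * integral {H..T} (\<lambda>t. (cmod (zeta (Complex \<sigma>0 t)))^2) \<le> E"
    using J H by (simp add: field_simps)
  ultimately show ?thesis unfolding E_def by blast
qed

end
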